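(* Let $\mathcal{A}$ be a properly infinite von Neumann algebra (acting on a Hilbert space $H$) and let $T\in\mathcal{A}$. Then the following statements hold. 1) $T$ is upper semi-$\mathcal{A}$-Weyl if and only if there exist some $S\in\mathcal{A}$ and $F\in\mathfrak{m}$ such that $S$ is bounded below and $T=S+F$. 2) $T$ is lower semi-$\mathcal{A}$-Weyl if and only if there exist some $S\in\mathcal{A}$ and $F\in\mathfrak{m}$ such that $S$ is surjective and $T=S+F$. 3) $T$ is $\mathcal{A}$-Weyl if and only if there exist some $S\in\mathcal{A}$ and $F\in\mathfrak{m}$ such that $S$ is invertible and $T=S+F$.
   Context: $\mathrm{Proj}_0(\mathcal{A})$ is the set of finite projections of $\mathcal{A}$ (projections not Murray-von Neumann equivalent to any proper subprojection). $\mathfrak{m}$ is the norm closure of the set of all $S\in\mathcal{A}$ such that the projection onto $\overline{\operatorname{Im}S}$ belongs to $\mathrm{Proj}_0(\mathcal{A})$; it is a selfadjoint ideal of $\mathcal{A}$. For projections $P,Q\in\mathcal{A}$: $P\sim Q$ means there is $V\in\mathcal{A}$ with $VV^*=P$, $V^*V=Q$; $P\preceq Q$ means there is a projection $P'\in\mathcal{A}$ with $P'\le Q$ and $P\sim P'$. $T\in\mathcal{A}$ is invertible up to the pair $(P,Q)$ of projections in $\mathcal{A}$ if, with $T'=(I-Q)T(I-P)$, there is $B\in\mathcal{A}$ with $B=(I-P)B(I-Q)$, $T'B=I-Q$, $BT'=I-P$. $T$ is upper semi-$\mathcal{A}$-Weyl, resp. lower semi-$\mathcal{A}$-Weyl,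 resp. $\mathcal{A}$-Weyl, if there are projections $P,Q\in\mathcal{A}$ such that $T$ is invertible up to $(P,Q)$ and $P\in\mathrm{Proj}_0(\mathcal{A})$, $P\preceq Q$, resp. $Q\in\mathrm{Proj}_0(\mathcal{A})$, $Q\preceq P$, resp. $P,Q\in\mathrm{Proj}_0(\mathcal{A})$, $P\sim Q$. *)

theory Defs
  imports "HOL-Analysis.Analysis"
begin

text \<open>
  Complex inner product spaces, conjugate-linear in the first argument. The underlying real inner
  product is the real part of the complex one, so that norm and topology are those of the
  class \<^class>\<open>real_inner\<close>; positive definiteness of \<open>cinner\<close> is inherited through
  \<open>inner_eq_Re_cinner\<close>.
\<close>

class complex_inner = real_inner +
  fixes scaleC :: "complex \<Rightarrow> 'a \<Rightarrow> 'a" (infixr \<open>*\<^sub>C\<close> 75)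
    and cinner :: "'a \<Rightarrow> 'a \<Rightarrow> complex"
  assumes scaleC_add_right: "c *\<^sub>C (x + y) = c *\<^sub>C x + c *\<^sub>C y"
    and scaleC_add_left: "(c + d) *\<^sub>C x = c *\<^sub>C x + d *\<^sub>C x"
    and scaleC_scaleC: "c *\<^sub>C d *\<^sub>C x = (c * d) *\<^sub>C x"
    and scaleC_of_real: "complex_of_real r *\<^sub>C x = r *\<^sub>R x"
    and cinner_commute: "cinner x y = cnj (cinner y x)"
    and cinner_add_left: "cinner (x + y) z = cinner x z + cinner y z"
    and cinner_scaleC_left: "cinner (c *\<^sub>C x) y = cnj c * cinner x y"
    and inner_eq_Re_cinner: "x \<bullet> y = Re (cinner x y)"

class chilbert_space = complex_inner + complete_space

instantiation complex :: chilbert_space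
begin

definition scaleC_complex :: "complex \<Rightarrow> complex \<Rightarrow> complex" where
  "scaleC_complex c x = c * x"

definition cinner_complex :: "complex \<Rightarrow> complex \<Rightarrow> complex" where
  "cinner_complex x y = cnj x * y"

instance
  by standard
    (auto simp: scaleC_complex_def cinner_complex_def algebra_simps scaleR_conv_of_real
      inner_complex_def)

end

text \<open>
  The type \<^typ>\<open>'a \<Rightarrow>\<^sub>L 'a\<close> consists of the bounded real-linear operators; \<open>bounded_ops\<close> is
  $B(H)$, with the operator norm inherited from that type.
\<close>

definition bounded_ops :: "('a::chilbert_space \<Rightarrow>\<^sub>L 'a) set" where
  "bounded_ops = {T. \<forall>c x. blinfun_apply T (c *\<^sub>C x) = c *\<^sub>C blinfun_apply T x}"

definition adj :: "('a::chilbert_space \<Rightarrow>\<^sub>L 'a) \<Rightarrow> ('a \<Rightarrow>\<^sub>L 'a)" where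
  "adj T = (THE S. \<forall>x y. cinner (blinfun_apply T x) y = cinner x (blinfun_apply S y))"

definition commutant :: "('a::chilbert_space \<Rightarrow>\<^sub>L 'a) set \<Rightarrow> ('a \<Rightarrow>\<^sub>L 'a) set" where
  "commutant M = {T \<in> bounded_ops. \<forall>S\<in>M. T o\<^sub>L S = S o\<^sub>L T}"

text \<open>
  A selfadjoint set of operators equal to its bicommutant. The unital subalgebra properties
  follow from the last condition, see the lemmas below.
\<close>

definition von_neumann_algebra :: "('a::chilbert_space \<Rightarrow>\<^sub>L 'a) set \<Rightarrow> bool" where
  "von_neumann_algebra A \<longleftrightarrow>
     A \<subseteq> bounded_ops \<and> (\<forall>T\<in>A. adj T \<in> A) \<and> commutant (commutant A) = A"

lemma blinfun_eq_pointwise: "S = T \<longleftrightarrow> (\<forall>x. blinfun_apply S x = blinfun_apply T x)"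
  by (auto intro: blinfun_eqI)

lemma commutant_id: "id_blinfun \<in> commutant M"
  by (auto simp: commutant_def bounded_ops_def intro!: blinfun_eqI)

lemma commutant_add: "S \<in> commutant M \<Longrightarrow> T \<in> commutant M \<Longrightarrow> S + T \<in> commutant M"
  by (auto simp: commutant_def bounded_ops_def scaleC_add_right blinfun.bilinear_simps
      blinfun_eq_pointwise)

lemma commutant_compose: "S \<in> commutant M \<Longrightarrow> T \<in> commutant M \<Longrightarrow> S o\<^sub>L T \<in> commutant M"
  by (auto simp: commutant_def bounded_ops_def blinfun_eq_pointwise)

lemma commutant_scaleC:
  assumes "M \<subseteq> bounded_ops" "T \<in> commutant M"
    and "\<And>x. blinfun_apply S x = c *\<^sub>C blinfun_apply T x"
  shows "S \<in> commutant M"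
  using assms by (auto simp: commutant_def bounded_ops_def blinfun_eq_pointwise scaleC_scaleC mult.commute)

lemma von_neumann_algebra_subalgebra:
  assumes "von_neumann_algebra A"
  shows "id_blinfun \<in> A"
    and "S \<in> A \<Longrightarrow> T \<in> A \<Longrightarrow> S + T \<in> A"
    and "S \<in> A \<Longrightarrow> T \<in> A \<Longrightarrow> S o\<^sub>L T \<in> A"
    and "T \<in> A \<Longrightarrow> (\<And>x. blinfun_apply S x = c *\<^sub>C blinfun_apply T x) \<Longrightarrow> S \<in> A"
proof -
  have A: "commutant (commutant A) = A" and B: "commutant A \<subseteq> bounded_ops"
    using assms by (auto simp: von_neumann_algebra_def commutant_def)
  show "id_blinfun \<in> A" using commutant_id A by metis
  show "S \<in> A \<Longrightarrow> T \<in> A \<Longrightarrow> S + T \<in> A" using commutant_add A by metis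
  show "S \<in> A \<Longrightarrow> T \<in> A \<Longrightarrow> S o\<^sub>L T \<in> A" using commutant_compose A by metis
  show "T \<in> A \<Longrightarrow> (\<And>x. blinfun_apply S x = c *\<^sub>C blinfun_apply T x) \<Longrightarrow> S \<in> A"
    using commutant_scaleC[OF B] A by metis
qed

definition Proj :: "('a::chilbert_space \<Rightarrow>\<^sub>L 'a) set \<Rightarrow> ('a \<Rightarrow>\<^sub>L 'a) set" where
  "Proj A = {P \<in> A. P o\<^sub>L P = P \<and> adj P = P}"

definition proj_le :: "('a::chilbert_space \<Rightarrow>\<^sub>L 'a) \<Rightarrow> ('a \<Rightarrow>\<^sub>L 'a) \<Rightarrow> bool" where
  "proj_le P Q \<longleftrightarrow> range (blinfun_apply P) \<subseteq> range (blinfun_apply Q)"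

definition mvn_equiv ::
    "('a::chilbert_space \<Rightarrow>\<^sub>L 'a) set \<Rightarrow> ('a \<Rightarrow>\<^sub>L 'a) \<Rightarrow> ('a \<Rightarrow>\<^sub>L 'a) \<Rightarrow> bool" where
  "mvn_equiv A P Q \<longleftrightarrow> (\<exists>V\<in>A. V o\<^sub>L adj V = P \<and> adj V o\<^sub>L V = Q)"

definition mvn_le ::
    "('a::chilbert_space \<Rightarrow>\<^sub>L 'a) set \<Rightarrow> ('a \<Rightarrow>\<^sub>L 'a) \<Rightarrow> ('a \<Rightarrow>\<^sub>L 'a) \<Rightarrow> bool" where
  "mvn_le A P Q \<longleftrightarrow> (\<exists>P'\<in>Proj A. proj_le P' Q \<and> mvn_equiv A P P')"

definition Proj0 :: "('a::chilbert_space \<Rightarrow>\<^sub>L 'a) set \<Rightarrow> ('a \<Rightarrow>\<^sub>L 'a) set" where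
  "Proj0 A = {P \<in> Proj A. \<not> (\<exists>P'\<in>Proj A. proj_le P' P \<and> P' \<noteq> P \<and> mvn_equiv A P P')}"

definition properly_infinite :: "('a::chilbert_space \<Rightarrow>\<^sub>L 'a) set \<Rightarrow> bool" where
  "properly_infinite A \<longleftrightarrow>
     (\<forall>P\<in>Proj A. (\<forall>T\<in>A. P o\<^sub>L T = T o\<^sub>L P) \<and> P \<noteq> 0 \<longrightarrow> P \<notin> Proj0 A)"

text \<open>
  An orthogonal projection is determined by its range, so the \<open>P\<close> below is the projection onto
  the closure of the image of \<open>S\<close>.
\<close>

definition fin_ideal :: "('a::chilbert_space \<Rightarrow>\<^sub>L 'a) set \<Rightarrow> ('a \<Rightarrow>\<^sub>L 'a) set" where
  "fin_ideal A = closure {S \<in> A. \<exists>P\<in>Proj0 A. range (blinfun_apply P) = closure (range (blinfun_apply S))}"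

definition invertible_up_to ::
    "('a::chilbert_space \<Rightarrow>\<^sub>L 'a) set \<Rightarrow> ('a \<Rightarrow>\<^sub>L 'a) \<Rightarrow> ('a \<Rightarrow>\<^sub>L 'a) \<Rightarrow> ('a \<Rightarrow>\<^sub>L 'a) \<Rightarrow> bool" where
  "invertible_up_to A T P Q \<longleftrightarrow>
     (let T' = (id_blinfun - Q) o\<^sub>L T o\<^sub>L (id_blinfun - P) in
        \<exists>B\<in>A. B = (id_blinfun - P) o\<^sub>L B o\<^sub>L (id_blinfun - Q) \<and>
          T' o\<^sub>L B = id_blinfun - Q \<and> B o\<^sub>L T' = id_blinfun - P)"

definition upper_semi_weyl :: "('a::chilbert_space \<Rightarrow>\<^sub>L 'a) set \<Rightarrow> ('a \<Rightarrow>\<^sub>L 'a) \<Rightarrow> bool" where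
  "upper_semi_weyl A T \<longleftrightarrow>
     (\<exists>P\<in>Proj A. \<exists>Q\<in>Proj A. invertible_up_to A T P Q \<and> P \<in> Proj0 A \<and> mvn_le A P Q)"

definition lower_semi_weyl :: "('a::chilbert_space \<Rightarrow>\<^sub>L 'a) set \<Rightarrow> ('a \<Rightarrow>\<^sub>L 'a) \<Rightarrow> bool" where
  "lower_semi_weyl A T \<longleftrightarrow>
     (\<exists>P\<in>Proj A. \<exists>Q\<in>Proj A. invertible_up_to A T P Q \<and> Q \<in> Proj0 A \<and> mvn_le A Q P)"

definition weyl :: "('a::chilbert_space \<Rightarrow>\<^sub>L 'a) set \<Rightarrow> ('a \<Rightarrow>\<^sub>L 'a) \<Rightarrow> bool" where
  "weyl A T \<longleftrightarrow>
     (\<exists>P\<in>Proj A. \<exists>Q\<in>Proj A. invertible_up_to A T P Q \<and>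
        P \<in> Proj0 A \<and> Q \<in> Proj0 A \<and> mvn_equiv A P Q)"

definition bounded_below :: "('a::chilbert_space \<Rightarrow>\<^sub>L 'a) \<Rightarrow> bool" where
  "bounded_below S \<longleftrightarrow> (\<exists>c>0. \<forall>x. c * norm x \<le> norm (blinfun_apply S x))"

definition invertible_in :: "('a::chilbert_space \<Rightarrow>\<^sub>L 'a) set \<Rightarrow> ('a \<Rightarrow>\<^sub>L 'a) \<Rightarrow> bool" where
  "invertible_in A S \<longleftrightarrow> (\<exists>R\<in>A. S o\<^sub>L R = id_blinfun \<and> R o\<^sub>L S = id_blinfun)"

end

theory Submission imports Defs begin

text \<open>
  Everything rests on the polar decomposition in \<open>A\<close>, which makes the range projections of \<open>X\<close>
  and \<open>X\<^sup>*\<close> equivalent.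

  If \<open>T\<close> is invertible up to \<open>(P, Q)\<close> with inverse \<open>B\<close>, and \<open>V\<close> is a partial isometry with
  \<open>V V\<^sup>* = P\<close> and \<open>V\<^sup>* V \<le> Q\<close>, then \<open>S = T (1 - P) + V\<^sup>*\<close> has the left inverse \<open>B + V (1 - T B)\<close>,
  which is two-sided if \<open>V\<^sup>* V = Q\<close>, and \<open>T - S\<close> vanishes on the kernel of the finite
  projection \<open>P\<close>.

  Conversely, boundedness from below and invertibility are open conditions, so in \<open>T = S + F\<close>
  one may assume that \<open>F\<close> has a finite range projection. Then \<open>T\<close> agrees with \<open>S\<close> on the kernel
  of the range projection \<open>P\<close> of \<open>F\<^sup>*\<close>, which is finite as well. Let \<open>Q\<close> be the projection onto the
  orthogonal complement of \<open>S (1 - P) H\<close>. If \<open>S\<close> is bounded below, \<open>T\<close> is invertible up to \<open>(P, Q)\<close>,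
  and the polar decomposition of \<open>Q S P\<close>, which is injective on \<open>P H\<close>, yields \<open>P \<preceq> Q\<close>; if \<open>S\<close> is
  also surjective, the range of \<open>Q S P\<close> is \<open>Q H\<close> and \<open>P \<sim> Q\<close>. The surjective case is dual to the
  bounded below one.
\<close>

instance chilbert_space \<subseteq> banach ..

section \<open>Orthogonal projections\<close>

lemma parallelogram_law:
  fixes x y :: "'a::real_inner"
  shows "(norm (x + y))\<^sup>2 + (norm (x - y))\<^sup>2 = 2 * (norm x)\<^sup>2 + 2 * (norm y)\<^sup>2"
  by (simp add: power2_norm_eq_inner inner_simps inner_commute)

lemma infdist_diameter_bound:
  fixes C :: "'a::real_inner set"
  assumes C: "convex C" "u \<in> C" "v \<in> C" and dist: "dist x u \<le> r" "dist x v \<le> r"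
  shows "(dist u v)\<^sup>2 \<le> 4 * r\<^sup>2 - 4 * (infdist x C)\<^sup>2"
proof -
  have "midpoint u v \<in> C"
    using closed_segment_subset[OF C(2,3,1)] by auto
  then have "infdist x C \<le> dist x (midpoint u v)" by (rule infdist_le)
  then have "(infdist x C)\<^sup>2 \<le> (dist x (midpoint u v))\<^sup>2"
    by (simp add: power_mono infdist_nonneg)
  moreover have "(2 * dist x (midpoint u v))\<^sup>2 + (dist u v)\<^sup>2 = 2 * (dist x u)\<^sup>2 + 2 * (dist x v)\<^sup>2"
  proof -
    have "(x - u) + (x - v) = 2 *\<^sub>R (x - midpoint u v)"
      by (simp add: midpoint_def algebra_simps scaleR_2)
    then have "norm ((x - u) + (x - v)) = 2 * dist x (midpoint u v)" by (simp add: dist_norm)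
    moreover have "norm ((x - u) - (x - v)) = dist u v" by (simp add: dist_norm norm_minus_commute)
    ultimately show ?thesis
      using parallelogram_law[of "x - u" "x - v"] by (simp add: dist_norm)
  qed
  moreover have "(dist x u)\<^sup>2 \<le> r\<^sup>2" "(dist x v)\<^sup>2 \<le> r\<^sup>2" using dist by (simp_all add: power_mono)
  ultimately show ?thesis by (simp add: power_mult_distrib)
qed

lemma near_closest_points_are_close:
  fixes C :: "'a::real_inner set"
  assumes "convex C" "e > 0"
  shows "\<exists>n. \<forall>u\<in>C \<inter> cball x (infdist x C + 1 / Suc n). \<forall>v\<in>C \<inter> cball x (infdist x C + 1 / Suc n).
    dist u v < e"
proof -
  define d where "d = infdist x C"
  have "(\<lambda>n. 4 * (d + 1 / Suc n)\<^sup>2 - 4 * d\<^sup>2) \<longlonglongrightarrow> 4 * (d + 0)\<^sup>2 - 4 * d\<^sup>2"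
    by (intro tendsto_intros LIMSEQ_Suc[OF lim_1_over_n])
  then have "\<forall>\<^sub>F n in sequentially. 4 * (d + 1 / Suc n)\<^sup>2 - 4 * d\<^sup>2 < e\<^sup>2"
    using \<open>e > 0\<close> by (intro order_tendstoD(2)) auto
  then obtain n where small: "4 * (d + 1 / Suc n)\<^sup>2 - 4 * d\<^sup>2 < e\<^sup>2"
    by (auto simp: eventually_sequentially)
  have "dist u v < e"
    if "u \<in> C" "v \<in> C" "dist x u \<le> d + 1 / Suc n" "dist x v \<le> d + 1 / Suc n" for u v
  proof -
    have "(dist u v)\<^sup>2 \<le> 4 * (d + 1 / Suc n)\<^sup>2 - 4 * d\<^sup>2"
      using infdist_diameter_bound[OF \<open>convex C\<close> that] by (simp add: d_def)
    then have "(dist u v)\<^sup>2 < e\<^sup>2" using small by (rule le_less_trans)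
    then show ?thesis using \<open>e > 0\<close> by (rule power_less_imp_less_base[OF _ less_imp_le])
  qed
  then show ?thesis by (intro exI[of _ n]) (auto simp: d_def)
qed

lemma exists_closest_point_convex:
  fixes C :: "'a::{real_inner,complete_space} set"
  assumes C: "convex C" "closed C" "C \<noteq> {}"
  shows "\<exists>p\<in>C. \<forall>u\<in>C. dist x p \<le> dist x u"
proof -
  define d where "d = infdist x C"
  define K where "K n = C \<inter> cball x (d + 1 / Suc n)" for n
  have "closed (K n)" for n using C by (simp add: K_def closed_Int)
  moreover have "K n \<noteq> {}" for n
  proof -
    have "(INF u\<in>C. dist x u) < d + 1 / Suc n" using C by (simp add: d_def infdist_notempty)
    then obtain u where "u \<in> C" "dist x u < d + 1 / Suc n"
      using cINF_greatest[OF C(3), of "d + 1 / Suc n" "dist x"] by force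
    then show ?thesis by (auto simp: K_def)
  qed
  moreover have "K n \<subseteq> K m" if "m \<le> n" for m n
  proof -
    have "1 / Suc n \<le> 1 / Suc m" using that by (simp add: frac_le)
    then show ?thesis by (auto simp: K_def)
  qed
  moreover have "\<exists>n. \<forall>u\<in>K n. \<forall>v\<in>K n. dist u v < e" if "e > 0" for e
    unfolding K_def d_def by (rule near_closest_points_are_close[OF C(1) that])
  ultimately have "\<exists>p. \<forall>n. p \<in> K n" by (rule decreasing_closed_nest) auto
  then obtain p where p_in_K: "\<And>n. p \<in> K n" by blast
  have "dist x p \<le> d"
  proof (rule LIMSEQ_le_const)
    show "(\<lambda>n. d + 1 / Suc n) \<longlonglongrightarrow> d"
      using tendsto_add[OF tendsto_const LIMSEQ_Suc[OF lim_1_over_n], of d] by simp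
    show "\<exists>N. \<forall>n\<ge>N. dist x p \<le> d + 1 / Suc n" using p_in_K by (auto simp: K_def)
  qed
  then show ?thesis using p_in_K[of 0] infdist_le[of _ C x] by (force simp: K_def d_def)
qed

lemma orthogonal_decomposition_unique:
  fixes M :: "'a::{real_inner,complete_space} set"
  assumes M: "subspace M" "closed M"
  shows "\<exists>!p. p \<in> M \<and> (\<forall>m\<in>M. (x - p) \<bullet> m = 0)"
proof (rule ex_ex1I)
  have convex: "convex M" and "M \<noteq> {}" using M subspace_imp_convex subspace_0 by auto
  then obtain p where "p \<in> M" and closest: "\<forall>u\<in>M. dist x p \<le> dist x u"
    using exists_closest_point_convex[OF _ M(2)] by blast
  have "(x - p) \<bullet> m \<le> 0" if "m \<in> M" for m
    using any_closest_point_dot[OF convex M(2) \<open>p \<in> M\<close> _ closest, of "p + m"]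
      subspace_add[OF M(1) \<open>p \<in> M\<close> that] by simp
  from this this[OF subspace_neg[OF M(1)]] have "(x - p) \<bullet> m = 0" if "m \<in> M" for m
    using that by (force simp: antisym)
  then show "\<exists>p. p \<in> M \<and> (\<forall>m\<in>M. (x - p) \<bullet> m = 0)" using \<open>p \<in> M\<close> by blast
next
  fix p q
  assume projections: "p \<in> M \<and> (\<forall>m\<in>M. (x - p) \<bullet> m = 0)" "q \<in> M \<and> (\<forall>m\<in>M. (x - q) \<bullet> m = 0)"
  then have "p - q \<in> M" using M by (simp add: subspace_diff)
  then have "(x - q) \<bullet> (p - q) - (x - p) \<bullet> (p - q) = 0" using projections by simp
  then have "(p - q) \<bullet> (p - q) = 0" by (simp add: inner_diff_left)
  then show "p = q" by simp
qed

definition orth_proj :: "'a::{real_inner,complete_space} set \<Rightarrow> 'a \<Rightarrow>\<^sub>L 'a" where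
  "orth_proj M = Blinfun (\<lambda>x. THE p. p \<in> M \<and> (\<forall>m\<in>M. (x - p) \<bullet> m = 0))"

context
  fixes M :: "'a::{real_inner,complete_space} set"
  assumes M: "subspace M" "closed M"
begin

lemma blinfun_apply_orth_proj:
  "orth_proj M x = (THE p. p \<in> M \<and> (\<forall>m\<in>M. (x - p) \<bullet> m = 0))"
proof -
  define f where "f x = (THE p. p \<in> M \<and> (\<forall>m\<in>M. (x - p) \<bullet> m = 0))" for x
  have f_in: "f x \<in> M" and f_residual: "\<And>m. m \<in> M \<Longrightarrow> (x - f x) \<bullet> m = 0" for x
    using theI'[OF orthogonal_decomposition_unique[OF M, of x]] by (auto simp: f_def)
  have f_eqI: "f x = p" if "p \<in> M" "\<And>m. m \<in> M \<Longrightarrow> (x - p) \<bullet> m = 0" for x p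
    unfolding f_def using that
    by (intro the1_equality orthogonal_decomposition_unique M) blast
  have "bounded_linear f"
  proof (rule bounded_linear_intro[where K = 1])
    show "f (x + y) = f x + f y" for x y
      using M f_in f_residual[of _ x] f_residual[of _ y]
      by (intro f_eqI) (auto simp: subspace_add inner_simps algebra_simps)
    show "f (r *\<^sub>R x) = r *\<^sub>R f x" for r x
      using M f_in f_residual[of _ x]
      by (intro f_eqI) (auto simp: subspace_scale inner_simps simp flip: scaleR_right_diff_distrib)
    show "norm (f x) \<le> norm x * 1" for x
    proof -
      have "f x \<bullet> f x = x \<bullet> f x"
        using f_residual[OF f_in[of x], of x] by (simp add: inner_diff_left)
      then have "norm (f x) * norm (f x) \<le> norm x * norm (f x)"
        by (metis norm_cauchy_schwarz power2_eq_square power2_norm_eq_inner)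
      then show ?thesis by (cases "f x = 0") auto
    qed
  qed
  then show ?thesis
    by (simp add: orth_proj_def bounded_linear_Blinfun_apply flip: f_def)
qed

lemma orth_proj_in: "orth_proj M x \<in> M"
  and orth_proj_residual: "m \<in> M \<Longrightarrow> (x - orth_proj M x) \<bullet> m = 0"
  using theI'[OF orthogonal_decomposition_unique[OF M, of x]]
  by (simp_all add: blinfun_apply_orth_proj)

lemma orth_proj_eqI:
  assumes "p \<in> M" "\<And>m. m \<in> M \<Longrightarrow> (x - p) \<bullet> m = 0"
  shows "orth_proj M x = p"
  unfolding blinfun_apply_orth_proj
  by (intro the1_equality orthogonal_decomposition_unique M) (simp add: assms)

lemma orth_proj_selfadjoint: "orth_proj M x \<bullet> y = x \<bullet> orth_proj M y"
  using orth_proj_residual[OF orth_proj_in, of x y] orth_proj_residual[OF orth_proj_in, of y x]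
  by (simp add: inner_diff_left) (simp add: inner_commute)

lemma orth_proj_eq_0_iff: "orth_proj M x = 0 \<longleftrightarrow> (\<forall>m\<in>M. x \<bullet> m = 0)"
  by (metis M(1) diff_zero orth_proj_eqI orth_proj_residual subspace_0)

end

lemma riesz_representation:
  fixes f :: "'a::{real_inner,complete_space} \<Rightarrow> real"
  assumes "bounded_linear f"
  shows "\<exists>w. \<forall>x. f x = x \<bullet> w"
proof (cases "\<forall>x. f x = 0")
  case False
  interpret f: bounded_linear f by fact
  obtain x0 where "f x0 \<noteq> 0" using False by blast
  let ?ker = "{x. f x = 0}"
  have ker: "subspace ?ker" "closed ?ker"
    by (auto simp: subspace_def f.add f.scaleR f.zero
        intro!: closed_Collect_eq continuous_intros f.continuous_on)
  define e where "e = x0 - orth_proj ?ker x0"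
  have "f e \<noteq> 0" using \<open>f x0 \<noteq> 0\<close> orth_proj_in[OF ker, of x0] by (simp add: e_def f.diff)
  then have "e \<noteq> 0" using f.zero by auto
  have "f x = x \<bullet> ((f e / (e \<bullet> e)) *\<^sub>R e)" for x
  proof -
    have "x - (f x / f e) *\<^sub>R e \<in> ?ker" using \<open>f e \<noteq> 0\<close> by (simp add: f.diff f.scaleR)
    then have "e \<bullet> (x - (f x / f e) *\<^sub>R e) = 0" unfolding e_def by (rule orth_proj_residual[OF ker])
    then have "x \<bullet> e = (f x / f e) * (e \<bullet> e)" by (simp add: inner_diff_right inner_commute)
    then show ?thesis using \<open>f e \<noteq> 0\<close> \<open>e \<noteq> 0\<close> by (simp add: field_simps)
  qed
  then show ?thesis by blast
qed (auto intro: exI[of _ 0])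

lemma subspace_closure:
  fixes M :: "'b::real_normed_vector set"
  assumes M: "subspace M"
  shows "subspace (closure M)"
  unfolding subspace_def
proof (intro conjI ballI allI)
  show "0 \<in> closure M" using subspace_0[OF M] closure_subset by blast
next
  fix x y assume "x \<in> closure M" "y \<in> closure M"
  then obtain f g where "\<And>n::nat. f n \<in> M" "f \<longlonglongrightarrow> x" "\<And>n::nat. g n \<in> M" "g \<longlonglongrightarrow> y"
    unfolding closure_sequential by blast
  then show "x + y \<in> closure M"
    unfolding closure_sequential using subspace_add[OF M]
    by (intro exI[of _ "\<lambda>n. f n + g n"]) (auto intro: tendsto_intros)
next
  fix c x assume "x \<in> closure M"
  then obtain f where "\<And>n::nat. f n \<in> M" "f \<longlonglongrightarrow> x" unfolding closure_sequential by blast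
  then show "c *\<^sub>R x \<in> closure M"
    unfolding closure_sequential using subspace_scale[OF M]
    by (intro exI[of _ "\<lambda>n. c *\<^sub>R f n"]) (auto intro: tendsto_intros)
qed

lemma closure_induct [consumes 1, case_names closed mem]:
  assumes "x \<in> closure M" "closed {x. P x}" "\<And>x. x \<in> M \<Longrightarrow> P x"
  shows "P x"
  using closure_minimal[of M "{x. P x}"] assms by auto

lemma subspace_range_blinfun: "subspace (range (blinfun_apply X))"
  by (rule linear_subspace_image) (simp_all add: bounded_linear.linear blinfun.bounded_linear_right)

definition range_proj ::
    "('a::real_normed_vector \<Rightarrow>\<^sub>L 'b::{real_inner,complete_space}) \<Rightarrow> 'b \<Rightarrow>\<^sub>L 'b" where
  "range_proj X = orth_proj (closure (range X))"

context
  fixes X :: "'a::real_normed_vector \<Rightarrow>\<^sub>L 'b::{real_inner,complete_space}"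
begin

lemmas closure_range_subspace = subspace_closure[OF subspace_range_blinfun[of X]] closed_closure

lemma range_proj_in_closure: "range_proj X x \<in> closure (range X)"
  unfolding range_proj_def by (rule orth_proj_in[OF closure_range_subspace])

lemma range_proj_selfadjoint: "range_proj X x \<bullet> y = x \<bullet> range_proj X y"
  unfolding range_proj_def by (rule orth_proj_selfadjoint[OF closure_range_subspace])

lemma range_proj_eq_self: "x \<in> closure (range X) \<Longrightarrow> range_proj X x = x"
  unfolding range_proj_def by (rule orth_proj_eqI[OF closure_range_subspace]) simp_all

lemma range_proj_apply [simp]: "range_proj X (X z) = X z"
  by (rule range_proj_eq_self[OF subsetD[OF closure_subset rangeI]])

lemma range_proj_idem [simp]: "range_proj X (range_proj X x) = range_proj X x"
  by (intro range_proj_eq_self range_proj_in_closure)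

lemma range_range_proj: "range (range_proj X) = closure (range X)"
  using range_proj_in_closure range_proj_eq_self[symmetric] by blast

lemma range_proj_induct [case_names closed range]:
  assumes "closed {y. P y}" "\<And>z. P (X z)"
  shows "P (range_proj X x)"
  using range_proj_in_closure by (rule closure_induct) (use assms in auto)

lemma range_proj_eq_0_iff: "range_proj X x = 0 \<longleftrightarrow> (\<forall>z. x \<bullet> X z = 0)"
proof -
  have "x \<bullet> m = 0" if "\<forall>z. x \<bullet> X z = 0" "m \<in> closure (range X)" for m
    using that(2)
  proof (induction rule: closure_induct)
    case closed
    show ?case by (intro closed_Collect_eq continuous_intros)
  qed (use that(1) in auto)
  then show ?thesis
    unfolding range_proj_def orth_proj_eq_0_iff[OF closure_range_subspace]
    using closure_subset[of "range X"] by blast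
qed

end

section \<open>Adjoints\<close>

lemma blinfun_compose_eqD: "S o\<^sub>L T = R \<Longrightarrow> S (T x) = R x"
  by auto

lemma blinfun_compose_assoc: "(X o\<^sub>L Y) o\<^sub>L Z = X o\<^sub>L (Y o\<^sub>L Z)"
  by (rule blinfun_eqI) simp

lemma norm_le_if_adjoint:
  fixes T :: "'a::real_inner \<Rightarrow>\<^sub>L 'b::real_inner"
  assumes "\<And>x. T x \<bullet> y = x \<bullet> z"
  shows "norm z \<le> norm T * norm y"
proof (cases "z = 0")
  case False
  have "norm z * norm z = T z \<bullet> y" by (simp add: assms norm_eq_sqrt_inner)
  also have "\<dots> \<le> norm T * norm z * norm y"
    by (meson norm_blinfun norm_cauchy_schwarz order_trans mult_right_mono norm_ge_zero)
  finally show ?thesis using False by (simp add: mult.commute mult.left_commute)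
qed simp

lemma exists_real_adjoint:
  fixes T :: "'a::{real_inner,complete_space} \<Rightarrow>\<^sub>L 'b::real_inner"
  shows "\<exists>S :: 'b \<Rightarrow>\<^sub>L 'a. \<forall>x y. T x \<bullet> y = x \<bullet> S y"
proof -
  have "\<exists>w. \<forall>x. T x \<bullet> y = x \<bullet> w" for y
    by (rule riesz_representation) (intro bounded_linear_intros)
  then obtain g where T_g: "\<And>x y. T x \<bullet> y = x \<bullet> g y" by metis
  have "bounded_linear g"
  proof (rule bounded_linear_intro[where K = "norm T"])
    show "g (x + y) = g x + g y" for x y
      by (rule vector_eq_ldot[THEN iffD1]) (simp add: inner_add_right flip: T_g)
    show "g (r *\<^sub>R x) = r *\<^sub>R g x" for r x
      by (rule vector_eq_ldot[THEN iffD1]) (simp flip: T_g)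
    show "norm (g y) \<le> norm y * norm T" for y
      using norm_le_if_adjoint[OF T_g] by (simp add: mult.commute)
  qed
  then show ?thesis
    using T_g by (intro exI[of _ "Blinfun g"]) (simp add: bounded_linear_Blinfun_apply)
qed

lemma cinner_scaleC_right: "cinner x (c *\<^sub>C y) = c * cinner x y"
  by (metis cinner_commute cinner_scaleC_left complex_cnj_cnj complex_cnj_mult)

lemma inner_scaleC_left: "(c *\<^sub>C x) \<bullet> y = x \<bullet> (cnj c *\<^sub>C y)" for x y :: "'a::complex_inner"
  by (simp add: inner_eq_Re_cinner cinner_scaleC_left cinner_scaleC_right)

lemma cinner_eq_inner:
  "cinner x y = Complex (x \<bullet> y) (- (x \<bullet> (\<i> *\<^sub>C y)))" for x y :: "'a::complex_inner"
  by (simp add: inner_eq_Re_cinner complex_eq_iff cinner_scaleC_right)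

lemma norm_scaleC: "norm (c *\<^sub>C x) = cmod c * norm x" for x :: "'a::complex_inner"
proof -
  have "(c *\<^sub>C x) \<bullet> (c *\<^sub>C x) = x \<bullet> ((cmod c)\<^sup>2 *\<^sub>R x)"
    unfolding inner_scaleC_left scaleC_scaleC
    by (simp add: mult.commute flip: scaleC_of_real complex_norm_square)
  then show ?thesis by (simp add: norm_eq_sqrt_inner real_sqrt_mult)
qed

lemma bounded_linear_scaleC: "bounded_linear (\<lambda>x::'a::complex_inner. c *\<^sub>C x)"
proof (rule bounded_linear_intro[where K = "cmod c"])
  show "c *\<^sub>C r *\<^sub>R x = r *\<^sub>R c *\<^sub>C x" for r and x :: 'a
    by (metis mult.commute scaleC_of_real scaleC_scaleC)
qed (simp_all add: scaleC_add_right norm_scaleC mult.commute)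

lemma bounded_ops_iff:
  "X \<in> bounded_ops \<longleftrightarrow> (\<forall>x. X (\<i> *\<^sub>C x) = \<i> *\<^sub>C X x)"
proof
  assume commutes_i: "\<forall>x. X (\<i> *\<^sub>C x) = \<i> *\<^sub>C X x"
  have decompose: "c *\<^sub>C x = Re c *\<^sub>R x + Im c *\<^sub>R (\<i> *\<^sub>C x)" for c and x :: 'a
  proof -
    have "c *\<^sub>C x = (complex_of_real (Re c) + complex_of_real (Im c) * \<i>) *\<^sub>C x"
      by (metis complex_eq mult.commute)
    then show ?thesis by (metis scaleC_add_left scaleC_of_real scaleC_scaleC)
  qed
  show "X \<in> bounded_ops"
    unfolding bounded_ops_def mem_Collect_eq
    by (subst decompose, subst (2) decompose) (simp add: blinfun.bilinear_simps commutes_i)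
qed (simp add: bounded_ops_def)

lemmas scaleC_linear = bounded_linear_scaleC[THEN bounded_linear.linear]

lemma bounded_ops_simps [simp]:
  fixes S T :: "'a::chilbert_space \<Rightarrow>\<^sub>L 'a"
  shows "(id_blinfun :: 'a \<Rightarrow>\<^sub>L 'a) \<in> bounded_ops" "(0 :: 'a \<Rightarrow>\<^sub>L 'a) \<in> bounded_ops"
    and "S \<in> bounded_ops \<Longrightarrow> T \<in> bounded_ops \<Longrightarrow> S + T \<in> bounded_ops"
    and "S \<in> bounded_ops \<Longrightarrow> T \<in> bounded_ops \<Longrightarrow> S - T \<in> bounded_ops"
    and "S \<in> bounded_ops \<Longrightarrow> T \<in> bounded_ops \<Longrightarrow> S o\<^sub>L T \<in> bounded_ops"
    and "S \<in> bounded_ops \<Longrightarrow> r *\<^sub>R S \<in> bounded_ops"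
  by (simp_all add: bounded_ops_iff blinfun.bilinear_simps scaleC_linear[THEN linear_0]
      scaleC_linear[THEN linear_add] scaleC_linear[THEN linear_diff]
      scaleC_linear[THEN linear_scale])

lemma real_adjoint_in_bounded_ops:
  fixes S T :: "'a::chilbert_space \<Rightarrow>\<^sub>L 'a"
  assumes T: "T \<in> bounded_ops" and ST: "\<And>x y. T x \<bullet> y = x \<bullet> S y"
  shows "S \<in> bounded_ops"
  unfolding bounded_ops_def
proof (clarify, rule vector_eq_ldot[THEN iffD1], intro allI)
  fix c x y
  have "x \<bullet> S (c *\<^sub>C y) = T (cnj c *\<^sub>C x) \<bullet> y"
    using T by (simp add: inner_scaleC_left bounded_ops_def flip: ST)
  also have "\<dots> = x \<bullet> (c *\<^sub>C S y)" by (simp add: ST inner_scaleC_left)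
  finally show "x \<bullet> S (c *\<^sub>C y) = x \<bullet> (c *\<^sub>C S y)" .
qed

lemma adj_eqI:
  fixes S T :: "'a::chilbert_space \<Rightarrow>\<^sub>L 'a"
  assumes T: "T \<in> bounded_ops" and ST: "\<And>x y. T x \<bullet> y = x \<bullet> S y"
  shows "adj T = S"
  unfolding adj_def
proof (rule the_equality)
  show "\<forall>x y. cinner (T x) y = cinner x (S y)"
    using real_adjoint_in_bounded_ops[OF T ST] by (simp add: cinner_eq_inner ST bounded_ops_def)
next
  fix R :: "'a \<Rightarrow>\<^sub>L 'a" assume "\<forall>x y. cinner (T x) y = cinner x (R y)"
  then have "x \<bullet> R y = x \<bullet> S y" for x y
    by (metis ST inner_eq_Re_cinner)
  then show "R = S" by (metis blinfun_eqI vector_eq_ldot)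
qed

lemma
  fixes T :: "'a::chilbert_space \<Rightarrow>\<^sub>L 'a"
  assumes T: "T \<in> bounded_ops"
  shows inner_adj_right: "x \<bullet> adj T y = T x \<bullet> y"
    and inner_adj_left: "adj T x \<bullet> y = x \<bullet> T y"
    and adj_in_bounded_ops [simp]: "adj T \<in> bounded_ops"
proof -
  obtain S :: "'a \<Rightarrow>\<^sub>L 'a" where S: "\<And>x y. T x \<bullet> y = x \<bullet> S y"
    using exists_real_adjoint[of T] by blast
  then show "x \<bullet> adj T y = T x \<bullet> y" "adj T x \<bullet> y = x \<bullet> T y" "adj T \<in> bounded_ops"
    using real_adjoint_in_bounded_ops[OF T S] adj_eqI[OF T S] by (auto simp: inner_commute)
qed

lemma adj_id [simp]: "adj id_blinfun = id_blinfun"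
  and adj_zero [simp]: "adj 0 = 0"
  and adj_adj [simp]: "T \<in> bounded_ops \<Longrightarrow> adj (adj T) = T"
  and adj_add [simp]: "S \<in> bounded_ops \<Longrightarrow> T \<in> bounded_ops \<Longrightarrow> adj (S + T) = adj S + adj T"
  and adj_diff [simp]: "S \<in> bounded_ops \<Longrightarrow> T \<in> bounded_ops \<Longrightarrow> adj (S - T) = adj S - adj T"
  and adj_compose [simp]:
    "S \<in> bounded_ops \<Longrightarrow> T \<in> bounded_ops \<Longrightarrow> adj (S o\<^sub>L T) = adj T o\<^sub>L adj S"
  and adj_scaleR [simp]: "T \<in> bounded_ops \<Longrightarrow> adj (r *\<^sub>R T) = r *\<^sub>R adj T"
  by (rule adj_eqI;
      simp add: inner_adj_right inner_adj_left blinfun.bilinear_simps inner_simps)+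

lemma norm_adj [simp]:
  assumes "T \<in> bounded_ops"
  shows "norm (adj T) = norm T"
proof -
  have "norm (adj S) \<le> norm S" if "S \<in> bounded_ops" for S :: "'a \<Rightarrow>\<^sub>L 'a"
    using that by (intro norm_blinfun_bound norm_le_if_adjoint) (simp_all add: inner_adj_right)
  from this[OF assms] this[OF adj_in_bounded_ops[OF assms]] show ?thesis using assms by simp
qed

lemma continuous_on_adj: "continuous_on bounded_ops adj"
proof -
  have "dist (adj S) (adj T) = dist S T" if "S \<in> bounded_ops" "T \<in> bounded_ops"
    for S T :: "'a::chilbert_space \<Rightarrow>\<^sub>L 'a"
    using norm_adj[of "S - T"] that by (simp add: dist_norm)
  then show ?thesis by (auto simp: continuous_on_iff)
qed

lemma inner_eq_if_norm_eq:
  fixes V :: "'a::real_normed_vector \<Rightarrow>\<^sub>L 'b::real_inner" and W :: "'a \<Rightarrow>\<^sub>L 'c::real_inner"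
  assumes "\<And>x. norm (V x) = norm (W x)"
  shows "V x \<bullet> V y = W x \<bullet> W y"
  unfolding dot_norm using assms[of "x + y"] by (simp add: assms blinfun.add_right)

lemma adj_compose_self_eq_iff:
  assumes "V \<in> bounded_ops" "W \<in> bounded_ops"
  shows "adj V o\<^sub>L V = adj W o\<^sub>L W \<longleftrightarrow> (\<forall>x. norm (V x) = norm (W x))"
proof -
  have inner: "x \<bullet> (adj V o\<^sub>L V) y = V x \<bullet> V y" "x \<bullet> (adj W o\<^sub>L W) y = W x \<bullet> W y" for x y
    using assms by (simp_all add: inner_adj_right)
  show ?thesis
  proof
    assume "adj V o\<^sub>L V = adj W o\<^sub>L W"
    then show "\<forall>x. norm (V x) = norm (W x)" using inner by (simp add: norm_eq_sqrt_inner)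
  next
    assume "\<forall>x. norm (V x) = norm (W x)"
    then have "V x \<bullet> V y = W x \<bullet> W y" for x y by (intro inner_eq_if_norm_eq) simp
    then show "adj V o\<^sub>L V = adj W o\<^sub>L W"
      by (intro blinfun_eqI vector_eq_ldot[THEN iffD1])
        (simp add: inner del: blinfun_apply_blinfun_compose)
  qed
qed

section \<open>Square roots and isometric extensions\<close>

text \<open>The limit \<open>y\<close> of the iterates satisfies \<open>(1 - y)\<^sup>2 = 1 - a\<close>. For \<open>\<parallel>a\<parallel> \<le> 1\<close> their increments
  are dominated by those of the scalar iteration for \<open>a = 1\<close>, which increases to 1.\<close>

primrec sqrt_iter :: "('a::real_normed_vector \<Rightarrow>\<^sub>L 'a) \<Rightarrow> nat \<Rightarrow> 'a \<Rightarrow>\<^sub>L 'a" where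
  "sqrt_iter a 0 = 0"
| "sqrt_iter a (Suc n) = (1/2) *\<^sub>R (a + (sqrt_iter a n o\<^sub>L sqrt_iter a n))"

primrec sqrt_majorant :: "nat \<Rightarrow> real" where
  "sqrt_majorant 0 = 0"
| "sqrt_majorant (Suc n) = (1 + (sqrt_majorant n)\<^sup>2) / 2"

lemma sqrt_majorant_bounds: "0 \<le> sqrt_majorant n \<and> sqrt_majorant n \<le> 1"
  by (induction n) (auto simp: power_le_one)

lemma incseq_sqrt_majorant: "incseq sqrt_majorant"
proof (rule incseq_SucI)
  fix n
  have "0 \<le> (sqrt_majorant n - 1)\<^sup>2" by simp
  then show "sqrt_majorant n \<le> sqrt_majorant (Suc n)" by (simp add: power2_eq_square algebra_simps)
qed

lemma norm_sqrt_iter_le: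
  assumes norm_a: "norm a \<le> 1"
  shows "norm (sqrt_iter a n) \<le> sqrt_majorant n"
proof (induction n)
  case (Suc n)
  have "norm (sqrt_iter a n o\<^sub>L sqrt_iter a n) \<le> sqrt_majorant n * sqrt_majorant n"
    using norm_blinfun_compose[of "sqrt_iter a n" "sqrt_iter a n"] mult_mono[OF Suc Suc]
      sqrt_majorant_bounds[of n] by simp
  then have "norm (a + (sqrt_iter a n o\<^sub>L sqrt_iter a n)) \<le> 1 + (sqrt_majorant n)\<^sup>2"
    using norm_a norm_triangle_ineq[of a "sqrt_iter a n o\<^sub>L sqrt_iter a n"]
    by (simp add: power2_eq_square)
  then show ?case by simp
qed simp

lemma norm_sqrt_iter_increment_le:
  assumes norm_a: "norm a \<le> 1"
  shows "norm (sqrt_iter a (Suc n) - sqrt_iter a n) \<le> sqrt_majorant (Suc n) - sqrt_majorant n"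
proof (induction n)
  case 0
  show ?case using norm_a by simp
next
  case (Suc n)
  let ?y = "sqrt_iter a" and ?r = sqrt_majorant
  let ?d = "?y (Suc n) - ?y n"
  have "(1/2) *\<^sub>R (a + (u o\<^sub>L u)) - (1/2) *\<^sub>R (a + (v o\<^sub>L v))
      = (1/2) *\<^sub>R ((u o\<^sub>L (u - v)) + ((u - v) o\<^sub>L v))" for u v
    by (rule blinfun_eqI) (simp add: blinfun.bilinear_simps algebra_simps)
  from this[of "?y (Suc n)" "?y n", folded sqrt_iter.simps]
  have "norm (?y (Suc (Suc n)) - ?y (Suc n)) \<le> (norm (?y (Suc n) o\<^sub>L ?d) + norm (?d o\<^sub>L ?y n)) / 2"
    using norm_triangle_ineq[of "?y (Suc n) o\<^sub>L ?d" "?d o\<^sub>L ?y n"]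
    by (simp del: sqrt_iter.simps)
  also have "\<dots> \<le> (?r (Suc n) * (?r (Suc n) - ?r n) + (?r (Suc n) - ?r n) * ?r n) / 2"
  proof -
    have "norm (?y (Suc n) o\<^sub>L ?d) \<le> ?r (Suc n) * (?r (Suc n) - ?r n)"
      using sqrt_majorant_bounds[of "Suc n"]
      by (intro order_trans[OF norm_blinfun_compose] mult_mono norm_sqrt_iter_le norm_a Suc) auto
    moreover have "norm (?d o\<^sub>L ?y n) \<le> (?r (Suc n) - ?r n) * ?r n"
      using incseq_SucD[OF incseq_sqrt_majorant, of n]
      by (intro order_trans[OF norm_blinfun_compose] mult_mono norm_sqrt_iter_le norm_a Suc) auto
    ultimately show ?thesis by (intro divide_right_mono add_mono) (assumption+, simp)
  qed
  also have "\<dots> = ?r (Suc (Suc n)) - ?r (Suc n)"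
    by (simp add: power2_eq_square field_simps)
  finally show ?case .
qed

lemma convergent_sqrt_iter:
  fixes a :: "'a::banach \<Rightarrow>\<^sub>L 'a"
  assumes norm_a: "norm a \<le> 1"
  shows "convergent (sqrt_iter a)"
proof -
  obtain l where "sqrt_majorant \<longlonglongrightarrow> l"
    using incseq_convergent[OF incseq_sqrt_majorant] sqrt_majorant_bounds by blast
  then have "summable (\<lambda>n. sqrt_majorant (Suc n) - sqrt_majorant n)" by (rule telescope_summable)
  then have "summable (\<lambda>n. sqrt_iter a (Suc n) - sqrt_iter a n)"
    by (rule summable_comparison_test') (rule norm_sqrt_iter_increment_le[OF norm_a])
  then have "convergent (\<lambda>n. \<Sum>k<n. sqrt_iter a (Suc k) - sqrt_iter a k)"
    by (simp only: summable_iff_convergent)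
  then show ?thesis by (simp only: sum_lessThan_telescope sqrt_iter.simps(1) diff_zero)
qed

lemma norm_id_minus_adj_compose_le:
  assumes W: "W \<in> bounded_ops" and norm_W: "norm W \<le> 1"
  shows "norm (id_blinfun - (adj W o\<^sub>L W)) \<le> 1"
proof (rule norm_blinfun_bound)
  fix z
  let ?w = "adj W (W z)"
  have "norm ?w \<le> norm (W z)"
    using norm_blinfun[of "adj W" "W z"] mult_right_mono[OF norm_W, of "norm (W z)"] W by simp
  then have "(norm ?w)\<^sup>2 \<le> (norm (W z))\<^sup>2" by (simp add: power_mono)
  moreover have "z \<bullet> ?w = (norm (W z))\<^sup>2"
    using W by (simp add: inner_adj_right power2_norm_eq_inner)
  moreover have "(norm (z - ?w))\<^sup>2 = (norm z)\<^sup>2 - 2 * (z \<bullet> ?w) + (norm ?w)\<^sup>2"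
    by (simp add: power2_norm_eq_inner inner_simps inner_commute)
  ultimately have "(norm (z - ?w))\<^sup>2 \<le> (norm z)\<^sup>2"
    using zero_le_power2[of "norm (W z)"] by linarith
  then have "norm (z - ?w) \<le> norm z" by (rule power2_le_imp_le) simp
  then show "norm ((id_blinfun - (adj W o\<^sub>L W)) z) \<le> 1 * norm z" by (simp add: blinfun.diff_left)
qed simp

definition joint_range ::
    "('a::real_normed_vector \<Rightarrow>\<^sub>L 'b::real_normed_vector) \<Rightarrow>
      ('a \<Rightarrow>\<^sub>L 'c::real_normed_vector) \<Rightarrow> ('b \<times> 'c) set" where
  "joint_range S X = closure (range (\<lambda>z. (S z, X z)))"

context
  fixes S X :: "'a::{real_inner,complete_space} \<Rightarrow>\<^sub>L 'a"
begin

lemma joint_range_closed_subspace: "subspace (joint_range S X)" "closed (joint_range S X)"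
proof -
  have "linear (\<lambda>z. (S z, X z))" by (auto intro!: linearI simp: blinfun.bilinear_simps)
  then have "subspace (range (\<lambda>z. (S z, X z)))" by (rule linear_subspace_image) simp
  then show "subspace (joint_range S X)" unfolding joint_range_def by (rule subspace_closure)
qed (simp add: joint_range_def)

lemma orthogonal_joint_range:
  assumes "m \<in> joint_range S X" "\<And>z. p \<bullet> (S z, X z) = 0"
  shows "p \<bullet> m = 0"
  using assms(1) unfolding joint_range_def
proof (induction rule: closure_induct)
  case closed
  show ?case by (intro closed_Collect_eq continuous_intros)
qed (use assms(2) in auto)

lemma orth_proj_joint_range_eq_0:
  assumes "range_proj S x = 0"
  shows "orth_proj (joint_range S X) (x, 0) = 0"
  unfolding orth_proj_eq_0_iff[OF joint_range_closed_subspace]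
  using assms by (auto simp: range_proj_eq_0_iff intro: orthogonal_joint_range)

text \<open>As the norms agree, the joint range is the graph of an isometry \<open>V\<close>, and \<open>(w, 0)\<close> is projected
  to \<open>(w, V w) / 2\<close>.\<close>

lemma orth_proj_joint_range:
  assumes norm_eq: "\<And>z. norm (S z) = norm (X z)"
  shows "orth_proj (joint_range S X) (S z, 0) = (1/2) *\<^sub>R (S z, X z)"
proof (rule orth_proj_eqI[OF joint_range_closed_subspace])
  have "(S z, X z) \<in> joint_range S X"
    unfolding joint_range_def by (rule subsetD[OF closure_subset]) simp
  then show "(1/2) *\<^sub>R (S z, X z) \<in> joint_range S X"
    by (rule subspace_scale[OF joint_range_closed_subspace(1)])
  have "S z \<bullet> S w = X z \<bullet> X w" for w by (rule inner_eq_if_norm_eq[OF norm_eq])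
  then show "((S z, 0) - (1/2) *\<^sub>R (S z, X z)) \<bullet> m = 0" if "m \<in> joint_range S X" for m
    using that by (intro orthogonal_joint_range[of m]) (simp_all add: inner_diff_left)
qed

lemma exists_isometric_extension:
  assumes norm_eq: "\<And>z. norm (S z) = norm (X z)"
  shows "\<exists>V :: 'a \<Rightarrow>\<^sub>L 'a. V o\<^sub>L S = X \<and> V o\<^sub>L range_proj S = V"
proof -
  define V where "V = Blinfun (\<lambda>x. 2 *\<^sub>R snd (orth_proj (joint_range S X) (x, 0)))"
  have V: "V x = 2 *\<^sub>R snd (orth_proj (joint_range S X) (x, 0))" for x
    unfolding V_def by (subst bounded_linear_Blinfun_apply) (auto intro!: bounded_linear_intros)
  have "V (S z) = X z" for z by (simp add: V orth_proj_joint_range[OF norm_eq])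
  moreover have "V (range_proj S x) = V x" for x
  proof -
    have "range_proj S (x - range_proj S x) = 0" by (simp add: blinfun.diff_right)
    then have "V (x - range_proj S x) = 0" by (simp add: V orth_proj_joint_range_eq_0)
    then show ?thesis by (simp add: blinfun.diff_right)
  qed
  ultimately show ?thesis by (auto simp: blinfun_eq_pointwise)
qed

end

section \<open>Boundedness from below\<close>

lemma bounded_below_if_left_inverse:
  assumes "L o\<^sub>L S = id_blinfun"
  shows "bounded_below S"
  unfolding bounded_below_def
proof (intro exI[of _ "1 / (norm L + 1)"] conjI allI)
  have norm_L_pos: "0 < norm L + 1" by (simp add: add_nonneg_pos)
  then show "0 < 1 / (norm L + 1)" by simp
  fix x
  have "norm x \<le> norm L * norm (S x)"
    using norm_blinfun[of L "S x"] blinfun_compose_eqD[OF assms] by simp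
  also have "\<dots> \<le> (norm L + 1) * norm (S x)" by (simp add: mult_right_mono)
  finally show "1 / (norm L + 1) * norm x \<le> norm (S x)"
    using norm_L_pos by (simp add: field_simps)
qed

lemma open_bounded_below: "open {S. bounded_below S}"
  unfolding open_dist
proof (intro ballI, elim CollectE)
  fix S :: "'a \<Rightarrow>\<^sub>L 'a"
  assume "bounded_below S"
  then obtain c where c_pos: "c > 0" and below: "\<And>x. c * norm x \<le> norm (S x)"
    by (auto simp: bounded_below_def)
  have "bounded_below R" if R: "dist R S < c / 2" for R
    unfolding bounded_below_def
  proof (intro exI[of _ "c / 2"] conjI allI)
    fix x
    have "norm ((R - S) x) \<le> c / 2 * norm x"
      using norm_blinfun[of "R - S" x] mult_right_mono[of "norm (R - S)" "c / 2" "norm x"] R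
      by (simp add: dist_norm)
    then show "c / 2 * norm x \<le> norm (R x)"
      using below[of x] norm_triangle_ineq2[of "S x" "R x"]
      by (simp add: blinfun.diff_left norm_minus_commute)
  qed (use c_pos in simp)
  then show "\<exists>e>0. \<forall>R. dist R S < e \<longrightarrow> R \<in> {S. bounded_below S}"
    using c_pos by (intro exI[of _ "c / 2"]) simp
qed

lemma exists_left_inverse_if_bounded_below:
  assumes "bounded_below X"
  shows "\<exists>L. L o\<^sub>L X = id_blinfun \<and> X o\<^sub>L L = range_proj X"
proof -
  obtain c where c_pos: "c > 0" and below: "\<And>x. c * norm x \<le> norm (X x)"
    using assms by (auto simp: bounded_below_def)
  have X_inj: "x = y" if "X x = X y" for x y
    using below[of "x - y"] that c_pos by (simp add: blinfun.diff_right mult_le_0_iff)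
  have "complete (range X)"
    using c_pos below by (intro complete_isometric_image[of c])
      (auto simp: blinfun.bounded_linear_right complete_UNIV)
  then have "closure (range X) = range X" by (simp add: complete_eq_closed)
  then have "\<exists>y. X y = range_proj X x" for x
    using range_proj_in_closure[of X x] by force
  then obtain l where X_l: "\<And>x. X (l x) = range_proj X x" by metis
  have "bounded_linear l"
  proof (rule bounded_linear_intro[where K = "norm (range_proj X) / c"])
    show "l (x + y) = l x + l y" for x y by (rule X_inj) (simp add: X_l blinfun.add_right)
    show "l (r *\<^sub>R x) = r *\<^sub>R l x" for r x by (rule X_inj) (simp add: X_l blinfun.scaleR_right)
    have "c * norm (l x) \<le> norm (range_proj X) * norm x" for x
      using below[of "l x"] norm_blinfun[of "range_proj X" x] by (simp add: X_l)
    then show "norm (l x) \<le> norm x * (norm (range_proj X) / c)" for x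
      using c_pos by (simp add: field_simps)
  qed
  then have apply_l: "Blinfun l x = l x" for x by (simp add: bounded_linear_Blinfun_apply)
  have "l (X x) = x" for x by (rule X_inj) (simp add: X_l)
  then show ?thesis
    by (intro exI[of _ "Blinfun l"]) (simp add: blinfun_eq_pointwise apply_l X_l)
qed

lemma weakly_bounded_imp_bounded:
  fixes W :: "'a::{real_inner,complete_space} set"
  assumes weakly_bounded: "\<And>x. \<exists>K. \<forall>w\<in>W. \<bar>w \<bullet> x\<bar> \<le> K"
  shows "bounded W"
proof -
  define C where "C k = (\<Inter>w\<in>W. {x. \<bar>w \<bullet> x\<bar> \<le> real k})" for k :: nat
  have closed_C: "closed (C k)" for k
    unfolding C_def by (intro closed_INT ballI closed_Collect_le continuous_intros)
  have "x \<in> (\<Union>k. C k)" for x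
  proof -
    obtain K where "\<forall>w\<in>W. \<bar>w \<bullet> x\<bar> \<le> K" using weakly_bounded by blast
    moreover obtain k where "K \<le> real k" using real_arch_simple by blast
    ultimately have "x \<in> C k" by (force simp: C_def)
    then show ?thesis by blast
  qed
  then have "(\<Union>k. C k) = UNIV" by blast
  moreover have "euclidean interior_of (\<Union>(range C)) = {}" if "\<And>k. interior (C k) = {}"
    using closed_C that
    by (intro Baire_category_alt disjI1 completely_metrizable_space_euclidean) auto
  ultimately obtain k x0 where "x0 \<in> interior (C k)" by fastforce
  then obtain r where r_pos: "r > 0" and cball_subset: "cball x0 r \<subseteq> C k"
    by (auto simp: mem_interior_cball)
  have "norm w \<le> 2 * real k / r" if w: "w \<in> W" for w
  proof (cases "w = 0")
    case False
    let ?x = "x0 + (r / norm w) *\<^sub>R w"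
    have "?x \<in> C k" "x0 \<in> C k" using r_pos cball_subset False by (auto simp: subset_iff dist_norm)
    then have "\<bar>w \<bullet> ?x\<bar> \<le> real k" "\<bar>w \<bullet> x0\<bar> \<le> real k" using w by (auto simp: C_def)
    moreover have "w \<bullet> ?x = w \<bullet> x0 + r * norm w"
      using False by (simp add: inner_add_right power2_norm_eq_inner[symmetric] power2_eq_square)
    ultimately have "r * norm w \<le> 2 * real k" by linarith
    then show ?thesis using r_pos by (simp add: field_simps)
  qed (use r_pos in simp)
  then show ?thesis by (auto simp: bounded_iff)
qed

text \<open>If \<open>X\<close> is surjective, the set of all \<open>w\<close> with \<open>\<parallel>X\<^sup>* w\<parallel> \<le> 1\<close> is weakly bounded.\<close>

lemma bounded_below_adj_if_surj:
  assumes X: "X \<in> bounded_ops" and surj: "surj X"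
  shows "bounded_below (adj X)"
proof -
  have "bounded {w. norm (adj X w) \<le> 1}"
  proof (rule weakly_bounded_imp_bounded)
    fix x
    obtain u where x_eq: "x = X u" using surj by blast
    have "\<bar>w \<bullet> x\<bar> \<le> norm u" if "norm (adj X w) \<le> 1" for w
    proof -
      have "\<bar>w \<bullet> x\<bar> = \<bar>adj X w \<bullet> u\<bar>" using X by (simp add: x_eq inner_adj_left)
      also have "\<dots> \<le> norm (adj X w) * norm u" by (rule Cauchy_Schwarz_ineq2)
      also have "\<dots> \<le> norm u" using that by (simp add: mult_left_le_one_le)
      finally show ?thesis .
    qed
    then show "\<exists>K. \<forall>w\<in>{w. norm (adj X w) \<le> 1}. \<bar>w \<bullet> x\<bar> \<le> K" by blast
  qed
  then obtain K where "K > 0" and norm_le: "\<And>w. norm (adj X w) \<le> 1 \<Longrightarrow> norm w \<le> K"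
    by (auto simp: bounded_pos)
  have "norm w \<le> K * norm (adj X w)" for w
  proof (cases "adj X w = 0")
    case True
    obtain u where "w = X u" using surj by blast
    then have "w \<bullet> w = adj X w \<bullet> u" using X by (simp add: inner_adj_left)
    then show ?thesis using True by simp
  next
    case False
    then show ?thesis
      using norm_le[of "(1 / norm (adj X w)) *\<^sub>R w"]
      by (simp add: blinfun.scaleR_right field_simps)
  qed
  then show ?thesis
    unfolding bounded_below_def
    using \<open>K > 0\<close> by (intro exI[of _ "1 / K"]) (simp add: field_simps)
qed

section \<open>Operators in a von Neumann algebra\<close>

locale vN_algebra =
  fixes A :: "('a::chilbert_space \<Rightarrow>\<^sub>L 'a) set"
  assumes von_neumann: "von_neumann_algebra A"
begin

lemma mem_bounded_ops [simp]: "X \<in> A \<Longrightarrow> X \<in> bounded_ops"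
  using von_neumann by (auto simp: von_neumann_algebra_def)

text \<open>Multiplication by \<open>\<i>\<close> lies in the commutant, so complex linearity need not be checked
  separately.\<close>

lemma mem_iff_commutes: "X \<in> A \<longleftrightarrow> (\<forall>Y\<in>commutant A. \<forall>x. X (Y x) = Y (X x))"
proof
  assume "X \<in> A"
  then show "\<forall>Y\<in>commutant A. \<forall>x. X (Y x) = Y (X x)"
    by (auto simp: commutant_def blinfun_eq_pointwise)
next
  assume commutes: "\<forall>Y\<in>commutant A. \<forall>x. X (Y x) = Y (X x)"
  have apply_i: "Blinfun (\<lambda>x::'a. \<i> *\<^sub>C x) x = \<i> *\<^sub>C x" for x
    by (simp add: bounded_linear_Blinfun_apply bounded_linear_scaleC)
  have "Blinfun (\<lambda>x. \<i> *\<^sub>C x) \<in> commutant A"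
    using mem_bounded_ops
    by (auto simp: commutant_def bounded_ops_iff blinfun_eq_pointwise apply_i)
  then have "X \<in> bounded_ops" using commutes by (force simp: bounded_ops_iff apply_i)
  then have "X \<in> commutant (commutant A)"
    using commutes by (auto simp: commutant_def blinfun_eq_pointwise)
  then show "X \<in> A" using von_neumann by (simp add: von_neumann_algebra_def)
qed

lemma mem_simps [simp]:
  shows "id_blinfun \<in> A" "0 \<in> A"
    and "S \<in> A \<Longrightarrow> T \<in> A \<Longrightarrow> S + T \<in> A"
    and "S \<in> A \<Longrightarrow> T \<in> A \<Longrightarrow> S - T \<in> A"
    and "S \<in> A \<Longrightarrow> T \<in> A \<Longrightarrow> S o\<^sub>L T \<in> A"
    and "S \<in> A \<Longrightarrow> r *\<^sub>R S \<in> A"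
    and "S \<in> A \<Longrightarrow> adj S \<in> A"
  using von_neumann by (auto simp: mem_iff_commutes blinfun.bilinear_simps von_neumann_algebra_def)

lemma closed_vN_algebra: "closed A"
proof -
  have "A = (\<Inter>Y\<in>commutant A. \<Inter>x. {X :: 'a \<Rightarrow>\<^sub>L 'a. X (blinfun_apply Y x) = blinfun_apply Y (X x)})"
    using mem_iff_commutes by auto
  also have "closed \<dots>"
    by (intro closed_INT ballI closed_Collect_eq continuous_intros)
  finally show ?thesis .
qed

lemma commutant_adj:
  assumes Y: "Y \<in> commutant A"
  shows "adj Y \<in> commutant A"
proof -
  have Y_bounded: "Y \<in> bounded_ops" using Y by (simp add: commutant_def)
  have "adj Y o\<^sub>L S = S o\<^sub>L adj Y" if "S \<in> A" for S
  proof -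
    have "adj (Y o\<^sub>L adj S) = adj (adj S o\<^sub>L Y)" using Y that by (simp add: commutant_def)
    then show ?thesis using Y_bounded that by simp
  qed
  then show ?thesis using Y_bounded by (simp add: commutant_def)
qed

lemma ProjI:
  assumes "P \<in> A" "\<And>x. P (P x) = P x" "\<And>x y. P x \<bullet> y = x \<bullet> P y"
  shows "P \<in> Proj A"
  using assms adj_eqI[of P P] by (simp add: Proj_def blinfun_eq_pointwise)

lemma Proj_mem [simp]: "P \<in> Proj A \<Longrightarrow> P \<in> A"
  and Proj_adj [simp]: "P \<in> Proj A \<Longrightarrow> adj P = P"
  and Proj_idem [simp]: "P \<in> Proj A \<Longrightarrow> P (P x) = P x"
  by (auto simp: Proj_def blinfun_eq_pointwise)

lemma Proj_inner: "P \<in> Proj A \<Longrightarrow> P x \<bullet> y = x \<bullet> P y"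
  using inner_adj_left[of P] by simp

lemma Proj_compl [simp]: "P \<in> Proj A \<Longrightarrow> id_blinfun - P \<in> Proj A"
  by (intro ProjI) (simp_all add: blinfun.bilinear_simps inner_simps Proj_inner)

lemma mem_range_Proj_iff: "P \<in> Proj A \<Longrightarrow> x \<in> range P \<longleftrightarrow> P x = x"
  by (metis Proj_idem rangeE rangeI)

lemma proj_le_iff_left:
  assumes "Q \<in> Proj A"
  shows "proj_le P Q \<longleftrightarrow> Q o\<^sub>L P = P"
  unfolding proj_le_def image_subset_iff mem_range_Proj_iff[OF assms] blinfun_eq_pointwise by simp

lemma proj_le_iff_right:
  assumes "P \<in> Proj A" "Q \<in> Proj A"
  shows "proj_le P Q \<longleftrightarrow> P o\<^sub>L Q = P"
proof -
  have "adj (Q o\<^sub>L P) = P o\<^sub>L Q" "adj (P o\<^sub>L Q) = Q o\<^sub>L P" using assms by simp_all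
  then show ?thesis unfolding proj_le_iff_left[OF assms(2)] using assms(1) by (metis Proj_adj)
qed

lemma proj_le_antisym:
  assumes "P \<in> Proj A" "Q \<in> Proj A" "proj_le P Q" "proj_le Q P"
  shows "P = Q"
  using assms proj_le_iff_left[of Q P] proj_le_iff_right[of Q P] by simp

lemma proj_le_if_ker_subset:
  assumes P: "P \<in> Proj A" and Q: "Q \<in> Proj A" and ker: "\<And>x. Q x = 0 \<Longrightarrow> P x = 0"
  shows "proj_le P Q"
proof -
  have "P (x - Q x) = 0" for x using Q by (intro ker) (simp add: blinfun.diff_right)
  then show ?thesis
    unfolding proj_le_iff_right[OF P Q] blinfun_eq_pointwise by (simp add: blinfun.diff_right)
qed

lemma Proj_eqI_ker:
  assumes "P \<in> Proj A" "Q \<in> Proj A" "\<And>x. P x = 0 \<longleftrightarrow> Q x = 0"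
  shows "P = Q"
  using assms by (intro proj_le_antisym proj_le_if_ker_subset) auto

lemma Proj_eqI_range:
  assumes "P \<in> Proj A" "Q \<in> Proj A" "range P = range Q"
  shows "P = Q"
  using assms by (intro proj_le_antisym) (auto simp: proj_le_def)

lemma range_proj_Proj [simp]:
  assumes X: "X \<in> A"
  shows "range_proj X \<in> Proj A"
proof -
  let ?E = "range_proj X"
  have invariant: "?E (Y (?E x)) = Y (?E x)" if "Y \<in> commutant A" for Y x
  proof (induction x rule: range_proj_induct)
    case closed
    show ?case by (intro closed_Collect_eq continuous_intros)
  next
    case (range z)
    have "Y (X z) = X (Y z)" using X that by (simp add: mem_iff_commutes)
    then show ?case by simp
  qed
  have "?E (Y x) = Y (?E x)" if Y: "Y \<in> commutant A" for Y x
  proof (rule vector_eq_ldot[THEN iffD1], intro allI)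
    fix w
    have Y_bounded: "Y \<in> bounded_ops" using Y by (simp add: commutant_def)
    have "w \<bullet> ?E (Y x) = adj Y (?E w) \<bullet> x"
      using Y_bounded by (simp add: inner_adj_left range_proj_selfadjoint)
    also have "\<dots> = ?E (adj Y (?E w)) \<bullet> x" using invariant[OF commutant_adj[OF Y]] by simp
    also have "\<dots> = w \<bullet> ?E (Y (?E x))"
      using Y_bounded by (simp add: inner_adj_left range_proj_selfadjoint)
    finally show "w \<bullet> ?E (Y x) = w \<bullet> Y (?E x)" by (simp add: invariant[OF Y])
  qed
  then show ?thesis by (intro ProjI) (simp_all add: mem_iff_commutes range_proj_selfadjoint)
qed

lemma range_proj_adj_eq_0_iff: "X \<in> A \<Longrightarrow> range_proj (adj X) x = 0 \<longleftrightarrow> X x = 0"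
  unfolding range_proj_eq_0_iff by (simp add: inner_adj_right)

section \<open>Polar decomposition and equivalence of projections\<close>

lemma exists_sqrt_id_minus:
  assumes a: "a \<in> A" "adj a = a" "norm a \<le> 1"
  shows "\<exists>S\<in>A. adj S = S \<and> S o\<^sub>L S = id_blinfun - a"
proof -
  have iter: "sqrt_iter a n \<in> A \<and> adj (sqrt_iter a n) = sqrt_iter a n" for n
    by (induction n) (auto simp: a adj_eqI)
  obtain L where L: "sqrt_iter a \<longlonglongrightarrow> L"
    using convergent_sqrt_iter[OF a(3)] by (auto simp: convergent_def)
  have "L \<in> A" using closed_sequentially[OF closed_vN_algebra] iter L by blast
  have "sqrt_iter a \<longlonglongrightarrow> adj L"
    using continuous_on_tendsto_compose[OF continuous_on_adj L] \<open>L \<in> A\<close> iter by simp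
  then have "adj L = L" using L by (rule LIMSEQ_unique)
  have "(\<lambda>n. sqrt_iter a (Suc n)) \<longlonglongrightarrow> (1/2) *\<^sub>R (a + (L o\<^sub>L L))"
    unfolding sqrt_iter.simps by (intro tendsto_intros L)
  then have limit: "L = (1/2) *\<^sub>R (a + (L o\<^sub>L L))"
    using LIMSEQ_Suc[OF L] LIMSEQ_unique by blast
  have "2 *\<^sub>R L = a + (L o\<^sub>L L)" by (subst limit) simp
  then have "a = 2 *\<^sub>R L - (L o\<^sub>L L)" by (simp add: algebra_simps)
  then have "(id_blinfun - L) o\<^sub>L (id_blinfun - L) = id_blinfun - a"
    by (intro blinfun_eqI) (simp add: blinfun.bilinear_simps scaleR_2)
  then show ?thesis using \<open>L \<in> A\<close> \<open>adj L = L\<close> by (intro bexI[of _ "id_blinfun - L"]) simp_all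
qed

lemma exists_selfadjoint_sqrt:
  assumes X: "X \<in> A"
  shows "\<exists>S\<in>A. adj S = S \<and> S o\<^sub>L S = adj X o\<^sub>L X"
proof -
  define c where "c = norm X + 1"
  have "c > 0" by (simp add: c_def add_nonneg_pos)
  define W where "W = (1 / c) *\<^sub>R X"
  have W: "W \<in> A" "norm W \<le> 1" using X \<open>c > 0\<close> by (simp_all add: W_def c_def field_simps)
  obtain S where S: "S \<in> A" "adj S = S" "S o\<^sub>L S = adj W o\<^sub>L W"
    using exists_sqrt_id_minus[of "id_blinfun - (adj W o\<^sub>L W)"] W norm_id_minus_adj_compose_le[of W]
    by auto
  have "(c *\<^sub>R S) o\<^sub>L (c *\<^sub>R S) = c\<^sup>2 *\<^sub>R (S o\<^sub>L S)"
    by (rule blinfun_eqI) (simp add: blinfun.bilinear_simps power2_eq_square)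
  also have "\<dots> = adj X o\<^sub>L X"
    unfolding S(3) using X \<open>c > 0\<close>
    by (intro blinfun_eqI) (simp add: W_def blinfun.bilinear_simps power2_eq_square)
  finally show ?thesis using S by (intro bexI[of _ "c *\<^sub>R S"]) simp_all
qed

lemma isometric_extension_mem:
  assumes SX: "S \<in> A" "X \<in> A" and V: "V o\<^sub>L S = X" "V o\<^sub>L range_proj S = V"
  shows "V \<in> A"
  unfolding mem_iff_commutes
proof (intro ballI allI)
  fix Y x assume Y: "Y \<in> commutant A"
  let ?E = "range_proj S"
  have "V (Y (?E x)) = Y (V (?E x))"
  proof (induction x rule: range_proj_induct)
    case closed
    show ?case by (intro closed_Collect_eq continuous_intros)
  next
    case (range z)
    have "Y (S z) = S (Y z)" "Y (X z) = X (Y z)" using SX Y by (simp_all add: mem_iff_commutes)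
    then show ?case using blinfun_compose_eqD[OF V(1)] by simp
  qed
  moreover have "?E \<in> A" using SX by simp
  then have "?E (Y x) = Y (?E x)" using Y by (simp add: mem_iff_commutes)
  ultimately show "V (Y x) = Y (V x)" using blinfun_compose_eqD[OF V(2)] by metis
qed

theorem polar_decomposition:
  assumes X: "X \<in> A"
  obtains V S where "V \<in> A" "S \<in> A" "V o\<^sub>L S = X"
    "adj V o\<^sub>L V = range_proj S" "range_proj S = range_proj (adj X)"
proof -
  obtain S where S: "S \<in> A" "adj S = S" "adj S o\<^sub>L S = adj X o\<^sub>L X"
    using exists_selfadjoint_sqrt[OF X] by auto
  then have norm_eq: "norm (S z) = norm (X z)" for z
    using adj_compose_self_eq_iff[of S X] X by simp
  obtain V where V: "V o\<^sub>L S = X" "V o\<^sub>L range_proj S = V"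
    using exists_isometric_extension[OF norm_eq] by blast
  let ?E = "range_proj S"
  have "V \<in> A" using S(1) X V by (rule isometric_extension_mem)
  have "norm (V (?E x)) = norm (?E x)" for x
  proof (induction x rule: range_proj_induct)
    case closed
    show ?case by (intro closed_Collect_eq continuous_intros)
  next
    case (range z)
    show ?case using blinfun_compose_eqD[OF V(1), of z] by (simp add: norm_eq)
  qed
  then have "norm (V x) = norm (?E x)" for x using blinfun_compose_eqD[OF V(2), of x] by metis
  then have "adj V o\<^sub>L V = adj ?E o\<^sub>L ?E"
    using adj_compose_self_eq_iff[of V ?E] \<open>V \<in> A\<close> S(1) by simp
  then have "adj V o\<^sub>L V = ?E" using S(1) by (simp add: blinfun_eq_pointwise)
  moreover have "?E = range_proj (adj X)"
  proof (rule Proj_eqI_ker)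
    have "?E x = 0 \<longleftrightarrow> X x = 0" for x
      using range_proj_adj_eq_0_iff[OF S(1)] norm_eq[of x] S(2) by (metis norm_eq_zero)
    then show "?E x = 0 \<longleftrightarrow> range_proj (adj X) x = 0" for x
      using range_proj_adj_eq_0_iff[OF X] by simp
  qed (use S(1) X in simp_all)
  ultimately show ?thesis using that \<open>V \<in> A\<close> S(1) V(1) by blast
qed

lemma partial_isometry_iff:
  assumes V: "V \<in> A"
  shows "V o\<^sub>L adj V \<in> Proj A \<longleftrightarrow> V o\<^sub>L adj V o\<^sub>L V = V"
proof
  let ?P = "V o\<^sub>L adj V"
  assume P: "?P \<in> Proj A"
  have "adj V (y - ?P y) = 0" for y
  proof -
    have "adj V (y - ?P y) \<bullet> adj V (y - ?P y) = (y - ?P y) \<bullet> ?P (y - ?P y)"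
      using V by (simp add: inner_adj_left)
    also have "?P (y - ?P y) = 0" using Proj_idem[OF P] by (simp only: blinfun.diff_right) simp
    finally show ?thesis by simp
  qed
  then have "adj V = adj V o\<^sub>L ?P" by (simp add: blinfun_eq_pointwise blinfun.diff_right)
  then have "adj (adj V) = adj (adj V o\<^sub>L ?P)" by (rule arg_cong)
  then show "?P o\<^sub>L V = V" using V by simp
next
  assume "V o\<^sub>L adj V o\<^sub>L V = V"
  then have "V (adj V (V x)) = V x" for x by (metis blinfun_apply_blinfun_compose)
  then show "V o\<^sub>L adj V \<in> Proj A"
    using V by (intro ProjI) (simp_all flip: inner_adj_left[of V] inner_adj_right[of V])
qed

lemma partial_isometry_adj_iff:
  assumes V: "V \<in> A"
  shows "adj V o\<^sub>L V \<in> Proj A \<longleftrightarrow> V o\<^sub>L adj V \<in> Proj A"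
proof -
  have "adj (V o\<^sub>L adj V o\<^sub>L V) = adj V o\<^sub>L V o\<^sub>L adj V"
    using V by (simp add: blinfun_eq_pointwise)
  then have "adj V o\<^sub>L V o\<^sub>L adj V = adj V \<longleftrightarrow> V o\<^sub>L adj V o\<^sub>L V = V"
    using V by (metis adj_adj mem_bounded_ops mem_simps(5,7))
  then show ?thesis using partial_isometry_iff[of V] partial_isometry_iff[of "adj V"] V by simp
qed

theorem mvn_equiv_range_proj_adj:
  assumes X: "X \<in> A"
  shows "mvn_equiv A (range_proj X) (range_proj (adj X))"
proof -
  obtain V S where V: "V \<in> A" "S \<in> A" "V o\<^sub>L S = X" "adj V o\<^sub>L V = range_proj S"
    and S: "range_proj S = range_proj (adj X)"
    using polar_decomposition[OF X] .
  have VV: "V o\<^sub>L adj V \<in> Proj A"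
    using partial_isometry_adj_iff[OF V(1)] V(2,4) by simp
  have "V o\<^sub>L adj V = range_proj X"
  proof (rule Proj_eqI_ker[OF VV])
    fix x
    have "range_proj X x = 0 \<longleftrightarrow> (\<forall>z. adj V x \<bullet> S z = 0)"
      using V(1) by (simp add: range_proj_eq_0_iff inner_adj_left flip: V(3))
    also have "\<dots> \<longleftrightarrow> (adj V o\<^sub>L V) (adj V x) = 0" by (simp only: V(4) range_proj_eq_0_iff)
    also have "\<dots> \<longleftrightarrow> (V o\<^sub>L adj V) x = 0"
      using Proj_idem[OF VV, of x] by (metis blinfun.zero_right blinfun_apply_blinfun_compose)
    finally show "(V o\<^sub>L adj V) x = 0 \<longleftrightarrow> range_proj X x = 0" by simp
  qed (use X in simp)
  then show ?thesis using V(1,4) S by (auto simp: mvn_equiv_def)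
qed

lemma partial_isometry_final_proj:
  assumes V: "V \<in> A" "V o\<^sub>L adj V = P" and P: "P \<in> Proj A"
  shows "P o\<^sub>L V = V" "adj V o\<^sub>L P = adj V"
proof -
  show PV: "P o\<^sub>L V = V" using partial_isometry_iff[OF V(1)] P V(2) by simp
  show "adj V o\<^sub>L P = adj V" using arg_cong[OF PV, of adj] V(1) P by simp
qed

lemma mvn_equivE:
  assumes "mvn_equiv A P Q" and P: "P \<in> Proj A"
  obtains V where "V \<in> A" "Q \<in> Proj A" "V o\<^sub>L adj V = P" "adj V o\<^sub>L V = Q"
    "P o\<^sub>L V = V" "adj V o\<^sub>L P = adj V" "V o\<^sub>L Q = V" "Q o\<^sub>L adj V = adj V"
proof -
  obtain V where V: "V \<in> A" "V o\<^sub>L adj V = P" "adj V o\<^sub>L V = Q"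
    using assms by (auto simp: mvn_equiv_def)
  have Q: "Q \<in> Proj A" using partial_isometry_adj_iff[OF V(1)] P V(2,3) by simp
  show thesis
    using partial_isometry_final_proj[OF V(1,2) P] partial_isometry_final_proj[of "adj V" Q] V Q
    by (intro that[of V]) simp_all
qed

lemma mvn_equiv_sym: "mvn_equiv A P Q \<Longrightarrow> mvn_equiv A Q P"
  unfolding mvn_equiv_def by (metis adj_adj mem_bounded_ops mem_simps(7))

lemma mvn_equiv_imp_mvn_le:
  assumes "mvn_equiv A P Q" "P \<in> Proj A"
  shows "mvn_le A P Q"
  unfolding mvn_le_def using assms by (auto simp: proj_le_def elim: mvn_equivE intro!: bexI[of _ Q])

section \<open>Finite projections and the ideal they generate\<close>

lemma Proj0_iff_corner_unitary:
  assumes P: "P \<in> Proj A"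
  shows "P \<in> Proj0 A \<longleftrightarrow>
    (\<forall>W\<in>A. W o\<^sub>L adj W = P \<and> W o\<^sub>L P = W \<longrightarrow> adj W o\<^sub>L W = P)"
proof -
  have "adj W o\<^sub>L W \<in> Proj A \<and> (proj_le (adj W o\<^sub>L W) P \<longleftrightarrow> W o\<^sub>L P = W)"
    if W: "W \<in> A" "W o\<^sub>L adj W = P" for W
  proof -
    have initial: "adj W o\<^sub>L W \<in> Proj A" using partial_isometry_adj_iff[OF W(1)] P W(2) by simp
    have WWW: "W o\<^sub>L (adj W o\<^sub>L W) = W"
      using partial_isometry_iff[OF W(1)] P W(2) by (simp add: blinfun_eq_pointwise)
    have "adj W o\<^sub>L W o\<^sub>L P = adj W o\<^sub>L W \<longleftrightarrow> W o\<^sub>L P = W"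
    proof
      assume "adj W o\<^sub>L W o\<^sub>L P = adj W o\<^sub>L W"
      then have "W o\<^sub>L (adj W o\<^sub>L W o\<^sub>L P) = W" by (simp add: WWW)
      then show "W o\<^sub>L P = W" using WWW by (simp add: blinfun_eq_pointwise)
    qed (simp add: blinfun_eq_pointwise)
    then show ?thesis using initial proj_le_iff_right[OF initial P] by simp
  qed
  then show ?thesis using P unfolding Proj0_def mvn_equiv_def by blast
qed

lemma Proj0_Proj [simp]: "P \<in> Proj0 A \<Longrightarrow> P \<in> Proj A"
  by (simp add: Proj0_def)

text \<open>A one-sided unitary \<open>W\<close> of \<open>P A P\<close> is transported to \<open>Q' A Q'\<close>, where \<open>P \<sim> Q' \<le> Q\<close>, and
  completed by \<open>Q - Q'\<close> to a one-sided unitary of \<open>Q A Q\<close>.\<close>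

lemma Proj0_if_mvn_le:
  assumes P: "P \<in> Proj A" and Q: "Q \<in> Proj0 A" and PQ: "mvn_le A P Q"
  shows "P \<in> Proj0 A"
  unfolding Proj0_iff_corner_unitary[OF P]
proof (intro ballI impI, elim conjE)
  fix W assume W: "W \<in> A" "W o\<^sub>L adj W = P" "W o\<^sub>L P = W"
  obtain Q' where Q': "Q' \<in> Proj A" "proj_le Q' Q" "mvn_equiv A P Q'"
    using PQ by (auto simp: mvn_le_def)
  have QQ': "Q o\<^sub>L Q' = Q'" "Q' o\<^sub>L Q = Q'"
    using Q' Q proj_le_iff_left[of Q Q'] proj_le_iff_right[of Q' Q] by simp_all
  obtain V where V: "V \<in> A" "V o\<^sub>L adj V = P" "adj V o\<^sub>L V = Q'"
    "P o\<^sub>L V = V" "adj V o\<^sub>L P = adj V" "V o\<^sub>L Q' = V" "Q' o\<^sub>L adj V = adj V"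
    using Q'(3) P by (rule mvn_equivE)
  have PW: "P o\<^sub>L W = W" "adj W o\<^sub>L P = adj W"
    using partial_isometry_final_proj[OF W(1,2) P] by auto
  have PW': "P o\<^sub>L adj W = adj W" using arg_cong[OF W(3), of adj] W(1) P by simp
  note compositions = QQ' V(2-) W(2,3) PW PW'
  note [simp] = compositions[THEN blinfun_compose_eqD]
  have QV: "Q (adj V x) = adj V x" and VQ: "V (Q x) = V x" for x
    using QQ' V(6,7) by (metis blinfun_apply_blinfun_compose)+
  define Z where "Z = (adj V o\<^sub>L W o\<^sub>L V) + (Q - Q')"
  have Z: "Z \<in> A" and adj_Z: "adj Z = (adj V o\<^sub>L adj W o\<^sub>L V) + (Q - Q')"
    using V(1) W(1) Q Q'(1) by (simp_all add: Z_def) (simp add: blinfun_eq_pointwise)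
  have "Z o\<^sub>L adj Z = Q" "Z o\<^sub>L Q = Z"
    unfolding adj_Z unfolding Z_def using Q Q'(1)
    by (simp_all add: blinfun_eq_pointwise blinfun.bilinear_simps QV VQ)
  then have "adj Z o\<^sub>L Z = Q" using Q Z Proj0_iff_corner_unitary[of Q] by simp
  moreover have "V o\<^sub>L (adj Z o\<^sub>L Z) o\<^sub>L adj V = adj W o\<^sub>L W"
    unfolding adj_Z unfolding Z_def using Q Q'(1)
    by (simp add: blinfun_eq_pointwise blinfun.bilinear_simps QV VQ)
  ultimately show "adj W o\<^sub>L W = P" by (simp add: blinfun_eq_pointwise QV)
qed

definition finite_range_ops :: "('a \<Rightarrow>\<^sub>L 'a) set" where
  "finite_range_ops = {X \<in> A. range_proj X \<in> Proj0 A}"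

lemma fin_ideal_eq_closure: "fin_ideal A = closure finite_range_ops"
proof -
  have "range P = closure (range X) \<longleftrightarrow> P = range_proj X" if "X \<in> A" "P \<in> Proj0 A" for X P
    using that by (metis Proj0_Proj Proj_eqI_range range_proj_Proj range_range_proj)
  then have "{X \<in> A. \<exists>P\<in>Proj0 A. range P = closure (range X)} = finite_range_ops"
    unfolding finite_range_ops_def by blast
  then show ?thesis by (simp add: fin_ideal_def)
qed

lemma finite_range_opsI:
  assumes X: "X \<in> A" and P: "P \<in> Proj0 A" and ker: "\<And>x. P x = 0 \<Longrightarrow> X x = 0"
  shows "X \<in> finite_range_ops"
proof -
  have "proj_le (range_proj (adj X)) P"
    using X P ker by (intro proj_le_if_ker_subset) (simp_all add: range_proj_adj_eq_0_iff)
  then have "mvn_le A (range_proj X) P"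
    unfolding mvn_le_def using mvn_equiv_range_proj_adj X
    by (intro bexI[of _ "range_proj (adj X)"]) simp_all
  then show ?thesis using Proj0_if_mvn_le[OF _ P] X by (simp add: finite_range_ops_def)
qed

lemma adj_finite_range_ops:
  assumes "X \<in> finite_range_ops"
  shows "adj X \<in> finite_range_ops"
proof -
  have X: "X \<in> A" "range_proj X \<in> Proj0 A" using assms by (auto simp: finite_range_ops_def)
  have "mvn_le A (range_proj (adj X)) (range_proj X)"
    using mvn_equiv_range_proj_adj[of "adj X"] X(1) by (intro mvn_equiv_imp_mvn_le) simp_all
  then show ?thesis using X Proj0_if_mvn_le by (simp add: finite_range_ops_def)
qed

lemma fin_ideal_subset: "fin_ideal A \<subseteq> A"
  unfolding fin_ideal_eq_closure
  by (rule closure_minimal[OF _ closed_vN_algebra]) (auto simp: finite_range_ops_def)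

lemma continuous_on_adj_algebra: "continuous_on A adj"
  using continuous_on_adj by (rule continuous_on_subset) auto

lemma adj_fin_ideal:
  assumes "F \<in> fin_ideal A"
  shows "adj F \<in> fin_ideal A"
proof -
  have "continuous_on (fin_ideal A) adj"
    using continuous_on_adj_algebra fin_ideal_subset by (rule continuous_on_subset)
  then have "adj ` fin_ideal A \<subseteq> fin_ideal A"
    unfolding fin_ideal_eq_closure
    by (rule image_closure_subset) (use adj_finite_range_ops closure_subset in auto)
  then show ?thesis using assms by blast
qed

section \<open>Bounded below and surjective operators of the algebra\<close>

lemma bounded_below_iff_left_inverse:
  assumes X: "X \<in> A"
  shows "bounded_below X \<longleftrightarrow> (\<exists>L\<in>A. L o\<^sub>L X = id_blinfun)"
proof
  assume "bounded_below X"
  then obtain L where L: "L o\<^sub>L X = id_blinfun" "X o\<^sub>L L = range_proj X"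
    using exists_left_inverse_if_bounded_below by blast
  have LX: "L (X x) = x" and XL: "X (L x) = range_proj X x" for x
    using blinfun_compose_eqD[OF L(1)] blinfun_compose_eqD[OF L(2)] by simp_all
  have "L \<in> A"
    unfolding mem_iff_commutes
  proof (intro ballI allI)
    fix Y x assume Y: "Y \<in> commutant A"
    have "range_proj X \<in> A" using X by simp
    then have "X (L (Y x)) = X (Y (L x))"
      using X Y by (simp add: mem_iff_commutes XL)
    then show "L (Y x) = Y (L x)" by (metis LX)
  qed
  then show "\<exists>L\<in>A. L o\<^sub>L X = id_blinfun" using L(1) by blast
qed (auto intro: bounded_below_if_left_inverse)

lemma surj_iff_adj_bounded_below:
  assumes X: "X \<in> A"
  shows "surj X \<longleftrightarrow> bounded_below (adj X)"
proof
  assume "bounded_below (adj X)"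
  then obtain L where L: "L \<in> A" "L o\<^sub>L adj X = id_blinfun"
    using bounded_below_iff_left_inverse[of "adj X"] X by auto
  have "X o\<^sub>L adj L = id_blinfun" using arg_cong[OF L(2), of adj] L(1) X by simp
  then show "surj X" by (metis blinfun_compose_eqD blinfun_apply_id_blinfun surjI)
qed (use X in \<open>simp add: bounded_below_adj_if_surj\<close>)

lemma invertible_in_iff:
  assumes X: "X \<in> A"
  shows "invertible_in A X \<longleftrightarrow> bounded_below X \<and> surj X"
proof
  assume "invertible_in A X"
  then obtain R where R: "X o\<^sub>L R = id_blinfun" "R o\<^sub>L X = id_blinfun"
    by (auto simp: invertible_in_def)
  have "X (R x) = x" for x using blinfun_compose_eqD[OF R(1)] by simp
  then show "bounded_below X \<and> surj X" using bounded_below_if_left_inverse[OF R(2)] by (metis surjI)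
next
  assume "bounded_below X \<and> surj X"
  then obtain L where "surj X" and L: "L \<in> A" "L o\<^sub>L X = id_blinfun"
    using bounded_below_iff_left_inverse[OF X] by blast
  have "X (L x) = x" for x
    using \<open>surj X\<close> blinfun_compose_eqD[OF L(2)] by (metis blinfun_apply_id_blinfun surjD)
  then have "X o\<^sub>L L = id_blinfun" by (intro blinfun_eqI) simp
  then show "invertible_in A X" using L by (auto simp: invertible_in_def)
qed

lemma openin_bounded_below: "openin (top_of_set A) {S \<in> A. bounded_below S}"
  using openin_open_Int[OF open_bounded_below, of A] by (simp add: Int_def)

lemma openin_invertible_in: "openin (top_of_set A) {S \<in> A. invertible_in A S}"
proof -
  have "openin (top_of_set A) (A \<inter> adj -` {S. bounded_below S})" (is "openin _ ?V")
    by (rule continuous_openin_preimage_gen[OF continuous_on_adj_algebra open_bounded_below])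
  with openin_bounded_below have "openin (top_of_set A) ({S \<in> A. bounded_below S} \<inter> ?V)"
    by (rule openin_Int)
  also have "{S \<in> A. bounded_below S} \<inter> ?V = {S \<in> A. invertible_in A S}"
    using invertible_in_iff surj_iff_adj_bounded_below by blast
  finally show ?thesis .
qed

lemma finite_range_decomposition:
  assumes U: "openin (top_of_set A) U" and S: "S \<in> U" and F: "F \<in> fin_ideal A"
  obtains R F' where "R \<in> U" "F' \<in> finite_range_ops" "S + F = R + F'"
proof -
  have "U \<subseteq> A" using U by (rule openin_imp_subset)
  obtain e where "e > 0" and near_S: "\<And>R. R \<in> A \<Longrightarrow> dist R S < e \<Longrightarrow> R \<in> U"
    using U S by (auto simp: openin_euclidean_subtopology_iff)
  obtain F' where F': "F' \<in> finite_range_ops" "dist F' F < e"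
    using F \<open>e > 0\<close> unfolding fin_ideal_eq_closure closure_approachable by blast
  have "S + F - F' \<in> A"
    using subsetD[OF \<open>U \<subseteq> A\<close> S] subsetD[OF fin_ideal_subset F] F'(1)
    by (simp add: finite_range_ops_def)
  then have "S + F - F' \<in> U"
    using F'(2) by (intro near_S) (simp_all add: dist_norm norm_minus_commute)
  then show thesis using that[of "S + F - F'" F'] F'(1) by simp
qed

section \<open>Invertibility up to a pair of projections\<close>

lemma invertible_up_to_iff:
  assumes "P \<in> Proj A" "Q \<in> Proj A"
  shows "invertible_up_to A T P Q \<longleftrightarrow>
    (\<exists>B\<in>A. P o\<^sub>L B = 0 \<and> B o\<^sub>L Q = 0 \<and>
      (id_blinfun - Q) o\<^sub>L T o\<^sub>L B = id_blinfun - Q \<and>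
      B o\<^sub>L T o\<^sub>L (id_blinfun - P) = id_blinfun - P)"
proof -
  have "B = (id_blinfun - P) o\<^sub>L B o\<^sub>L (id_blinfun - Q) \<longleftrightarrow> P o\<^sub>L B = 0 \<and> B o\<^sub>L Q = 0" for B
  proof
    assume B: "B = (id_blinfun - P) o\<^sub>L B o\<^sub>L (id_blinfun - Q)"
    show "P o\<^sub>L B = 0 \<and> B o\<^sub>L Q = 0"
      by (subst (1 2) B) (use assms in \<open>simp add: blinfun_eq_pointwise blinfun.bilinear_simps\<close>)
  qed (simp add: blinfun_eq_pointwise blinfun.bilinear_simps)
  moreover have "((id_blinfun - Q) o\<^sub>L T o\<^sub>L (id_blinfun - P)) o\<^sub>L B = (id_blinfun - Q) o\<^sub>L T o\<^sub>L B"
    "B o\<^sub>L ((id_blinfun - Q) o\<^sub>L T o\<^sub>L (id_blinfun - P)) = B o\<^sub>L T o\<^sub>L (id_blinfun - P)"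
    if "P o\<^sub>L B = 0" "B o\<^sub>L Q = 0" for B
    using that by (simp_all add: blinfun_eq_pointwise blinfun.bilinear_simps)
  ultimately show ?thesis by (auto simp: invertible_up_to_def Let_def)
qed

lemma invertible_up_to_cong:
  assumes "T o\<^sub>L (id_blinfun - P) = R o\<^sub>L (id_blinfun - P)"
  shows "invertible_up_to A T P Q \<longleftrightarrow> invertible_up_to A R P Q"
proof -
  have "(id_blinfun - Q) o\<^sub>L T o\<^sub>L (id_blinfun - P) = (id_blinfun - Q) o\<^sub>L R o\<^sub>L (id_blinfun - P)"
    using assms by (simp add: blinfun_compose_assoc)
  then show ?thesis by (simp add: invertible_up_to_def)
qed

lemma invertible_up_to_adj:
  assumes T: "T \<in> A" and PQ: "P \<in> Proj A" "Q \<in> Proj A" and "invertible_up_to A T P Q"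
  shows "invertible_up_to A (adj T) Q P"
proof -
  obtain B where B: "B \<in> A" "P o\<^sub>L B = 0" "B o\<^sub>L Q = 0"
    "(id_blinfun - Q) o\<^sub>L T o\<^sub>L B = id_blinfun - Q" "B o\<^sub>L T o\<^sub>L (id_blinfun - P) = id_blinfun - P"
    using assms by (auto simp: invertible_up_to_iff)
  have "adj B o\<^sub>L P = 0" using arg_cong[OF B(2), of adj] B(1) PQ by simp
  moreover have "Q o\<^sub>L adj B = 0" using arg_cong[OF B(3), of adj] B(1) PQ by simp
  moreover have "adj B o\<^sub>L adj T o\<^sub>L (id_blinfun - Q) = id_blinfun - Q"
    using arg_cong[OF B(4), of adj] B(1) T PQ by (simp add: blinfun_compose_assoc)
  moreover have "(id_blinfun - P) o\<^sub>L adj T o\<^sub>L adj B = id_blinfun - P"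
    using arg_cong[OF B(5), of adj] B(1) T PQ by (simp add: blinfun_compose_assoc)
  ultimately show ?thesis using B(1) PQ by (auto simp: invertible_up_to_iff)
qed

lemma invertible_up_to_adj_iff:
  assumes "T \<in> A" "P \<in> Proj A" "Q \<in> Proj A"
  shows "invertible_up_to A (adj T) Q P \<longleftrightarrow> invertible_up_to A T P Q"
  using assms invertible_up_to_adj[of T P Q] invertible_up_to_adj[of "adj T" Q P] by auto

section \<open>From Weyl operators to decompositions\<close>

context
  fixes T B P Q V S L :: "'a \<Rightarrow>\<^sub>L 'a"
  assumes P: "P \<in> Proj A" and Q: "Q \<in> Proj A"
    and B: "P o\<^sub>L B = 0" "B o\<^sub>L Q = 0"
      "(id_blinfun - Q) o\<^sub>L T o\<^sub>L B = id_blinfun - Q"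
      "B o\<^sub>L T o\<^sub>L (id_blinfun - P) = id_blinfun - P"
    and V: "V \<in> A" "V o\<^sub>L adj V = P" "Q o\<^sub>L adj V = adj V"
    and S: "S = (T o\<^sub>L (id_blinfun - P)) + adj V"
    and L: "L = B + (V o\<^sub>L (id_blinfun - (T o\<^sub>L B)))"
begin

lemma partial_isometry_completion_left_inverse: "L o\<^sub>L S = id_blinfun"
proof (rule blinfun_eqI)
  fix x
  let ?y = "T (x - P x)"
  have S_x: "S x = ?y + adj V x" by (simp add: S blinfun.add_left blinfun.diff_left)
  have "B ?y = x - P x" using blinfun_compose_eqD[OF B(4), of x] by (simp add: blinfun.diff_left)
  moreover have "B (adj V x) = 0"
    using blinfun_compose_eqD[OF B(2), of "adj V x"] blinfun_compose_eqD[OF V(3), of x] by simp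
  ultimately have "B (S x) = x - P x" by (simp add: S_x blinfun.add_right)
  then have "(L o\<^sub>L S) x = x - P x + V (adj V x)"
    by (simp add: L S_x blinfun.add_left blinfun.diff_left)
  then show "(L o\<^sub>L S) x = id_blinfun x" using blinfun_compose_eqD[OF V(2), of x] by simp
qed

lemma partial_isometry_completion_right_inverse:
  assumes VV: "adj V o\<^sub>L V = Q"
  shows "S o\<^sub>L L = id_blinfun"
proof (rule blinfun_eqI)
  fix x
  let ?t = "T (B x)"
  note PV = partial_isometry_final_proj[OF V(1,2) P, THEN blinfun_compose_eqD]
  have PB: "P (B x) = 0" using blinfun_compose_eqD[OF B(1), of x] by simp
  have L_x: "L x = B x + V (x - ?t)" by (simp add: L blinfun.add_left blinfun.diff_left)
  have "L x - P (L x) = B x" using PV(1) by (simp add: L_x blinfun.add_right PB)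
  moreover have "adj V (L x) = Q (x - ?t)"
    using PV(2)[of "B x"] blinfun_compose_eqD[OF VV] by (simp add: L_x blinfun.add_right PB)
  ultimately have "(S o\<^sub>L L) x = ?t + Q (x - ?t)"
    by (simp add: S blinfun.add_left blinfun.diff_left)
  also have "\<dots> = x"
    using blinfun_compose_eqD[OF B(3), of x]
    by (simp add: blinfun.diff_left blinfun.diff_right algebra_simps)
  finally show "(S o\<^sub>L L) x = id_blinfun x" by simp
qed

end

lemma partial_isometry_completion_decomposition:
  assumes T: "T \<in> A" and P: "P \<in> Proj0 A" and Q: "Q \<in> Proj A" and inv: "invertible_up_to A T P Q"
    and V: "V \<in> A" "V o\<^sub>L adj V = P" "Q o\<^sub>L adj V = adj V"
  obtains S F L where "S \<in> A" "F \<in> fin_ideal A" "T = S + F" "L \<in> A" "L o\<^sub>L S = id_blinfun"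
    "adj V o\<^sub>L V = Q \<Longrightarrow> S o\<^sub>L L = id_blinfun"
proof -
  have P_Proj: "P \<in> Proj A" using P by simp
  obtain B where B: "B \<in> A" "P o\<^sub>L B = 0" "B o\<^sub>L Q = 0"
    "(id_blinfun - Q) o\<^sub>L T o\<^sub>L B = id_blinfun - Q"
    "B o\<^sub>L T o\<^sub>L (id_blinfun - P) = id_blinfun - P"
    using inv P_Proj Q by (auto simp: invertible_up_to_iff)
  define S where "S = (T o\<^sub>L (id_blinfun - P)) + adj V"
  define L where "L = B + (V o\<^sub>L (id_blinfun - (T o\<^sub>L B)))"
  have mem: "S \<in> A" "L \<in> A" using T B(1) V(1) P by (simp_all add: S_def L_def)
  have "(T - S) x = 0" if "P x = 0" for x
    using that blinfun_compose_eqD[OF partial_isometry_final_proj(2)[OF V(1,2) P_Proj], of x]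
    by (simp add: S_def blinfun.bilinear_simps)
  then have "T - S \<in> finite_range_ops" using T mem by (intro finite_range_opsI[OF _ P]) simp_all
  then have "T - S \<in> fin_ideal A"
    unfolding fin_ideal_eq_closure by (rule subsetD[OF closure_subset])
  then show thesis
    using that[of S "T - S" L] mem
      partial_isometry_completion_left_inverse[OF P_Proj Q B(2-) V S_def L_def]
      partial_isometry_completion_right_inverse[OF P_Proj Q B(2-) V S_def L_def] by simp
qed

lemma upper_semi_weyl_imp_decomposition:
  assumes T: "T \<in> A" and "upper_semi_weyl A T"
  shows "\<exists>S\<in>A. \<exists>F\<in>fin_ideal A. bounded_below S \<and> T = S + F"
proof -
  obtain P Q P' where PQ: "P \<in> Proj0 A" "Q \<in> Proj A" "invertible_up_to A T P Q"
    and P': "P' \<in> Proj A" "proj_le P' Q" "mvn_equiv A P P'"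
    using assms(2) by (auto simp: upper_semi_weyl_def mvn_le_def)
  obtain V where V: "V \<in> A" "V o\<^sub>L adj V = P" "P' o\<^sub>L adj V = adj V"
    using P'(3) Proj0_Proj[OF PQ(1)] by (rule mvn_equivE)
  have "Q o\<^sub>L P' = P'" using P'(2) PQ(2) by (simp add: proj_le_iff_left)
  then have "Q o\<^sub>L adj V = adj V" using V(3) by (metis blinfun_compose_assoc)
  then show ?thesis
    using partial_isometry_completion_decomposition[OF T PQ V(1,2)] bounded_below_if_left_inverse
    by metis
qed

lemma weyl_imp_decomposition:
  assumes T: "T \<in> A" and "weyl A T"
  shows "\<exists>S\<in>A. \<exists>F\<in>fin_ideal A. invertible_in A S \<and> T = S + F"
proof -
  obtain P Q where PQ: "P \<in> Proj0 A" "Q \<in> Proj A" "invertible_up_to A T P Q" "mvn_equiv A P Q"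
    using assms(2) by (auto simp: weyl_def)
  obtain V where V: "V \<in> A" "V o\<^sub>L adj V = P" "Q o\<^sub>L adj V = adj V" "adj V o\<^sub>L V = Q"
    using PQ(4) Proj0_Proj[OF PQ(1)] by (rule mvn_equivE)
  show ?thesis
    using partial_isometry_completion_decomposition[OF T PQ(1-3) V(1-3)] V(4)
    unfolding invertible_in_def by metis
qed

section \<open>From decompositions to Weyl operators\<close>

definition defect_proj :: "('a \<Rightarrow>\<^sub>L 'a) \<Rightarrow> ('a \<Rightarrow>\<^sub>L 'a) \<Rightarrow> 'a \<Rightarrow>\<^sub>L 'a" where
  "defect_proj R P = id_blinfun - range_proj (R o\<^sub>L (id_blinfun - P))"

lemma defect_proj_Proj [simp]: "R \<in> A \<Longrightarrow> P \<in> Proj A \<Longrightarrow> defect_proj R P \<in> Proj A"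
  by (simp add: defect_proj_def)

lemma left_inverse_range_proj:
  assumes L: "L o\<^sub>L R = id_blinfun" and P: "P \<in> Proj A"
  defines "E \<equiv> range_proj (R o\<^sub>L (id_blinfun - P))"
  shows "P (L (E x)) = 0" "R (L (E x)) = E x"
proof -
  have LR: "L (R y) = y" for y using blinfun_compose_eqD[OF L] by simp
  have "P (L (E x)) = 0 \<and> R (L (E x)) = E x"
    unfolding E_def
    by (induction x rule: range_proj_induct)
      (use P in \<open>auto simp: LR blinfun.diff_left blinfun.diff_right
        intro!: closed_Collect_conj closed_Collect_eq continuous_intros\<close>)
  then show "P (L (E x)) = 0" "R (L (E x)) = E x" by auto
qed

lemma invertible_up_to_defect_proj:
  assumes R: "R \<in> A" "bounded_below R" and P: "P \<in> Proj A"
  shows "invertible_up_to A R P (defect_proj R P)"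
proof -
  obtain L where L: "L \<in> A" "L o\<^sub>L R = id_blinfun"
    using R bounded_below_iff_left_inverse by blast
  define E where "E = range_proj (R o\<^sub>L (id_blinfun - P))"
  have E: "E \<in> Proj A" and Q: "defect_proj R P = id_blinfun - E"
    using R(1) P by (simp_all add: E_def defect_proj_def)
  note LE = left_inverse_range_proj[OF L(2) P, folded E_def]
  have "E (R (x - P x)) = R (x - P x)" for x
    using range_proj_apply[of "R o\<^sub>L (id_blinfun - P)" x] by (simp add: E_def blinfun.diff_left)
  then have "(L o\<^sub>L E) o\<^sub>L R o\<^sub>L (id_blinfun - P) = id_blinfun - P"
    using blinfun_compose_eqD[OF L(2)] by (simp add: blinfun_eq_pointwise blinfun.diff_left)
  moreover have "P o\<^sub>L (L o\<^sub>L E) = 0" "(L o\<^sub>L E) o\<^sub>L defect_proj R P = 0"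
    "(id_blinfun - defect_proj R P) o\<^sub>L R o\<^sub>L (L o\<^sub>L E) = id_blinfun - defect_proj R P"
    using E by (simp_all add: Q blinfun_eq_pointwise LE blinfun.bilinear_simps)
  ultimately show ?thesis
    using L(1) E R(1) P by (auto simp: invertible_up_to_iff intro!: bexI[of _ "L o\<^sub>L E"])
qed

lemma mvn_equiv_range_compression:
  assumes R: "R \<in> A" "bounded_below R" and P: "P \<in> Proj A"
  shows "mvn_equiv A P (range_proj (defect_proj R P o\<^sub>L R o\<^sub>L P))"
proof -
  let ?C = "defect_proj R P o\<^sub>L R o\<^sub>L P" and ?E = "range_proj (R o\<^sub>L (id_blinfun - P))"
  have C: "?C \<in> A" using R(1) P by simp
  obtain L where L: "L o\<^sub>L R = id_blinfun"
    using R bounded_below_iff_left_inverse by blast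
  have "P x = 0" if "?C x = 0" for x
  proof -
    have "R (P x) = ?E (R (P x))" using that by (simp add: defect_proj_def blinfun.diff_left)
    then have "P (L (R (P x))) = 0" using left_inverse_range_proj(1)[OF L P] by metis
    then show ?thesis using blinfun_compose_eqD[OF L] P by simp
  qed
  then have "range_proj (adj ?C) = P"
    using C P by (intro Proj_eqI_ker) (auto simp: range_proj_adj_eq_0_iff)
  then show ?thesis using mvn_equiv_range_proj_adj[OF C] by (simp add: mvn_equiv_sym)
qed

lemma mvn_le_defect_proj:
  assumes R: "R \<in> A" "bounded_below R" and P: "P \<in> Proj A"
  shows "mvn_le A P (defect_proj R P)"
  unfolding mvn_le_def
proof (intro bexI conjI)
  let ?Q = "defect_proj R P"
  show "proj_le (range_proj (?Q o\<^sub>L R o\<^sub>L P)) ?Q"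
    using R(1) P
    by (intro proj_le_if_ker_subset) (simp_all add: range_proj_eq_0_iff flip: Proj_inner)
qed (use assms mvn_equiv_range_compression in simp_all)

lemma mvn_equiv_defect_proj:
  assumes R: "R \<in> A" "bounded_below R" "surj R" and P: "P \<in> Proj A"
  shows "mvn_equiv A P (defect_proj R P)"
proof -
  let ?Q = "defect_proj R P"
  have "?Q (R (z - P z)) = 0" for z
    using range_proj_apply[of "R o\<^sub>L (id_blinfun - P)" z]
    by (simp add: defect_proj_def blinfun.diff_left)
  then have QRP: "?Q (R (P z)) = ?Q (R z)" for z by (simp add: blinfun.diff_right)
  have "?Q x = 0" if "\<And>z. ?Q x \<bullet> R z = 0" for x
    using that \<open>surj R\<close> by (metis inner_eq_zero_iff surjD)
  then have "range_proj (?Q o\<^sub>L R o\<^sub>L P) = ?Q"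
    using R(1) P by (intro Proj_eqI_ker) (auto simp: range_proj_eq_0_iff QRP simp flip: Proj_inner)
  then show ?thesis using mvn_equiv_range_compression[OF R(1,2) P] by simp
qed

lemma finite_range_perturbation_invertible_up_to:
  assumes R: "R \<in> A" "bounded_below R" and F: "F \<in> finite_range_ops"
  obtains P where "P \<in> Proj0 A" "invertible_up_to A (R + F) P (defect_proj R P)"
proof
  let ?P = "range_proj (adj F)"
  have "F \<in> A" using F by (simp add: finite_range_ops_def)
  show P: "?P \<in> Proj0 A" using adj_finite_range_ops[OF F] by (simp add: finite_range_ops_def)
  have "F (x - ?P x) = 0" for x
    using range_proj_adj_eq_0_iff[OF \<open>F \<in> A\<close>, of "x - ?P x"] by (simp add: blinfun.diff_right)
  then have "(R + F) o\<^sub>L (id_blinfun - ?P) = R o\<^sub>L (id_blinfun - ?P)"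
    by (simp add: blinfun_eq_pointwise blinfun.add_left blinfun.diff_left)
  then show "invertible_up_to A (R + F) ?P (defect_proj R ?P)"
    using invertible_up_to_defect_proj[OF R Proj0_Proj[OF P]] invertible_up_to_cong by blast
qed

lemma upper_semi_weyl_if_decomposition:
  assumes S: "S \<in> A" "bounded_below S" and F: "F \<in> fin_ideal A"
  shows "upper_semi_weyl A (S + F)"
proof -
  obtain R F' where R: "R \<in> A" "bounded_below R" and "F' \<in> finite_range_ops" "S + F = R + F'"
    by (rule finite_range_decomposition[OF openin_bounded_below _ F, of S]) (use S in blast)+
  then obtain P where "P \<in> Proj0 A" "invertible_up_to A (S + F) P (defect_proj R P)"
    using finite_range_perturbation_invertible_up_to by metis
  then show ?thesis
    unfolding upper_semi_weyl_def using R mvn_le_defect_proj by (meson Proj0_Proj defect_proj_Proj)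
qed

lemma weyl_if_decomposition:
  assumes S: "S \<in> A" "invertible_in A S" and F: "F \<in> fin_ideal A"
  shows "weyl A (S + F)"
proof -
  obtain R F' where "R \<in> A" "invertible_in A R" and F': "F' \<in> finite_range_ops" "S + F = R + F'"
    by (rule finite_range_decomposition[OF openin_invertible_in _ F, of S]) (use S in blast)+
  then have R: "R \<in> A" "bounded_below R" "surj R" by (simp_all add: invertible_in_iff)
  with F' obtain P where P: "P \<in> Proj0 A" "invertible_up_to A (S + F) P (defect_proj R P)"
    using finite_range_perturbation_invertible_up_to by metis
  let ?Q = "defect_proj R P"
  have PQ: "mvn_equiv A P ?Q" using mvn_equiv_defect_proj[OF R] P(1) by simp
  then have "mvn_le A ?Q P" using R(1) P(1) by (simp add: mvn_equiv_sym mvn_equiv_imp_mvn_le)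
  then have "?Q \<in> Proj0 A" using Proj0_if_mvn_le[OF _ P(1)] R(1) P(1) by simp
  then show ?thesis unfolding weyl_def using P PQ by (meson Proj0_Proj)
qed

section \<open>Characterization of Weyl operators\<close>

lemma lower_semi_weyl_iff_adj:
  assumes "T \<in> A"
  shows "lower_semi_weyl A T \<longleftrightarrow> upper_semi_weyl A (adj T)"
  unfolding lower_semi_weyl_def upper_semi_weyl_def
  using invertible_up_to_adj_iff[OF assms] by blast

lemma decomposition_adj_iff:
  assumes T: "T \<in> A"
  shows "(\<exists>S\<in>A. \<exists>F\<in>fin_ideal A. \<Phi> (adj S) \<and> T = S + F) \<longleftrightarrow>
    (\<exists>S\<in>A. \<exists>F\<in>fin_ideal A. \<Phi> S \<and> adj T = S + F)"
proof (intro iffI; elim bexE conjE)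
  fix S F assume "S \<in> A" "F \<in> fin_ideal A" "\<Phi> (adj S)" "T = S + F"
  then show "\<exists>S\<in>A. \<exists>F\<in>fin_ideal A. \<Phi> S \<and> adj T = S + F"
    using fin_ideal_subset
    by (intro bexI[of _ "adj S"] bexI[of _ "adj F"]) (auto intro: adj_fin_ideal)
next
  fix S F assume SF: "S \<in> A" "F \<in> fin_ideal A" "\<Phi> S" "adj T = S + F"
  have "T = adj S + adj F"
    using arg_cong[OF SF(4), of adj] SF(1,2) T fin_ideal_subset by auto
  then show "\<exists>S\<in>A. \<exists>F\<in>fin_ideal A. \<Phi> (adj S) \<and> T = S + F"
    using SF by (intro bexI[of _ "adj S"] bexI[of _ "adj F"]) (auto intro: adj_fin_ideal)
qed

theorem upper_semi_weyl_iff_decomposition: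
  assumes "T \<in> A"
  shows "upper_semi_weyl A T \<longleftrightarrow> (\<exists>S\<in>A. \<exists>F\<in>fin_ideal A. bounded_below S \<and> T = S + F)"
  using upper_semi_weyl_imp_decomposition[OF assms] upper_semi_weyl_if_decomposition by blast

theorem lower_semi_weyl_iff_decomposition:
  assumes T: "T \<in> A"
  shows "lower_semi_weyl A T \<longleftrightarrow> (\<exists>S\<in>A. \<exists>F\<in>fin_ideal A. surj (blinfun_apply S) \<and> T = S + F)"
proof -
  have "lower_semi_weyl A T \<longleftrightarrow> (\<exists>S\<in>A. \<exists>F\<in>fin_ideal A. bounded_below S \<and> adj T = S + F)"
    using T by (simp add: lower_semi_weyl_iff_adj upper_semi_weyl_iff_decomposition)
  also have "\<dots> \<longleftrightarrow> (\<exists>S\<in>A. \<exists>F\<in>fin_ideal A. bounded_below (adj S) \<and> T = S + F)"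
    using decomposition_adj_iff[OF T] by (rule sym)
  also have "\<dots> \<longleftrightarrow> (\<exists>S\<in>A. \<exists>F\<in>fin_ideal A. surj (blinfun_apply S) \<and> T = S + F)"
    using surj_iff_adj_bounded_below by auto
  finally show ?thesis .
qed

theorem weyl_iff_decomposition:
  assumes "T \<in> A"
  shows "weyl A T \<longleftrightarrow> (\<exists>S\<in>A. \<exists>F\<in>fin_ideal A. invertible_in A S \<and> T = S + F)"
  using weyl_imp_decomposition[OF assms] weyl_if_decomposition by blast

end

theorem corollary4p9:
  fixes A :: "('a::chilbert_space \<Rightarrow>\<^sub>L 'a) set"
    and T :: "'a \<Rightarrow>\<^sub>L 'a"
  assumes "von_neumann_algebra A"
    and "properly_infinite A"
    and "T \<in> A"
  shows "(upper_semi_weyl A T \<longleftrightarrow>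
            (\<exists>S\<in>A. \<exists>F\<in>fin_ideal A. bounded_below S \<and> T = S + F)) \<and>
         (lower_semi_weyl A T \<longleftrightarrow>
            (\<exists>S\<in>A. \<exists>F\<in>fin_ideal A. surj (blinfun_apply S) \<and> T = S + F)) \<and>
         (weyl A T \<longleftrightarrow>
            (\<exists>S\<in>A. \<exists>F\<in>fin_ideal A. invertible_in A S \<and> T = S + F))"
proof -
  interpret vN_algebra A by standard (rule assms(1))
  show ?thesis
    using upper_semi_weyl_iff_decomposition[OF assms(3)]
      lower_semi_weyl_iff_decomposition[OF assms(3)] weyl_iff_decomposition[OF assms(3)]
    by blast
qed

end
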